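(* Let each $f_i$ be $L$-smooth and $\mu$-strongly convex with $\mu>0$ and $L\ge2\mu$, and let $g$ be convex (possibly non-smooth). Run the modified ODAPG algorithm (described in the context) with $\widehat\gamma=\frac{1}{20\sqrt{(L-\mu)\mu}}$, $\widehat\tau=\mu\widehat\gamma$ and $K=\frac{11}{\sqrt{1-\lambda_2(W)}}$. Let $x^*$ denote the minimizer of $F$. Then the output $\mathbf{z}_T$ satisfies $$\begin{aligned}\|\mathbf{z}_T-\mathbf{1}x^*\|^2\le{}&\left(1-\frac{1}{40}\sqrt{\frac{\mu}{L-\mu}}\right)^T\Bigg(\frac{2m}{\mu}\big(F(\overline{y}_1)-F(x^* )\big)+\|\mathbf{z}_1-\mathbf{1}x^*\|^2\\&+\frac{6\cdot20^2(L-\mu)}{\mu}\Big(\|\Pi\mathbf{x}_1\|^2+c_1\|\Pi\mathbf{y}_1\|^2+c_2\|\Pi\mathbf{z}_1\|^2+c_3\widehat\gamma^2\|\Pi\mathbf{s}_1\|^2\Big)\Bigg),\end{aligned}$$ with $c_1=64$, $c_2=\frac{9\widehat\tau^2}{32}$ and $c_3=\frac{5\widehat\tau^2}{14}$.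
   Context: Problem: $f_1,\dots,f_m:\mathbb{R}^d\to\mathbb{R}$ and $g:\mathbb{R}^d\to\mathbb{R}$; $f(x)=\frac1m\sum_{i=1}^m f_i(x)$, $F(x)=f(x)+g(x)$. Each agent $i\in\{1,\dots,m\}$ of a connected undirected static network holds $f_i$. $L$-smooth means $f_i(y)\le f_i(x)+\langle\nabla f_i(x),y-x\rangle+\frac L2\|x-y\|^2$ for all $x,y$; $\mu$-strongly convex means $f_i(y)\ge f_i(x)+\langle\nabla f_i(x),y-x\rangle+\frac\mu2\|x-y\|^2$ for all $x,y$. Weight matrix: $W\in\mathbb{R}^{m\times m}$ is symmetric, $W_{i,j}\ne0$ iff agents $i,j$ are connected or $i=j$, $\mathbf{0}\preceq W\preceq I$, $W\mathbf{1}=\mathbf{1}$, $\mathrm{null}(I-W)=\mathrm{span}(\mathbf{1})$; $\lambda_2(W)$ is its second largest eigenvalue. Notation: vectors of $\mathbb{R}^d$ are identified with row vectors. Bold letters $\mathbf{x},\mathbf{y},\mathbf{z},\mathbf{s}$ denote $m\times d$ matrices with $i$-th row $\mathbf{x}^{(i)}$, etc.; $\overline{x}=\frac1m\mathbf{1}^\top\mathbf{x}$ (similarly $\overline y,\overline z,\overline s$), $\mathbf{1}\in\mathbb{R}^m$ the all-ones vector, $\Pi=I_m-\frac{\mathbf{1}\mathbf{1}^\top}{m}$. $\|\cdot\|$ is the Frobenius (Euclidean) norm. $\mathrm{prox}_{\gamma g}(\mathbf{x})$ is the $m\times d$ matrix with $i$-th row $\mathrm{argmin}_{w\in\mathbb{R}^d}\{\gamma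 g(w)+\frac12\|w-\mathbf{x}^{(i)}\|^2\}$. $\nabla\widehat f(\mathbf{x})$ is the $m\times d$ matrix with $i$-th row $\nabla f_i(\mathbf{x}^{(i)})-\mu\mathbf{x}^{(i)}$. $\mathrm{FastMix}(\mathbf{x},K)$: set $\mathbf{x}^0=\mathbf{x}^1=\mathbf{x}$, $\eta_w=1/(1+\sqrt{1-\lambda_2^2(W)})$, and for $k=1,\dots,K$ let $\mathbf{x}^{k+1}=(1+\eta_w)W\mathbf{x}^k-\eta_w\mathbf{x}^{k-1}$; the output is $\mathbf{x}^K$. ($K$ is an iteration count, understood as a positive integer.) Modified ODAPG: given $x_1\in\mathbb{R}^d$, set $\mathbf{z}_1=\mathbf{y}_1=\mathbf{x}_1=\mathbf{1}x_1$ and $\mathbf{s}_1=\nabla\widehat f(\mathbf{x}_1)$ (i.e. $\mathbf{s}_1^{(i)}=\nabla f_i(x_1)-\mu x_1$). For $t=1,2,\dots$: $\mathbf{x}_{t+1}=\widehat\tau\mathbf{z}_t+(1-\widehat\tau)\mathbf{y}_t$; $\mathbf{s}_{t+1}=\mathrm{FastMix}(\mathbf{s}_t+\nabla\widehat f(\mathbf{x}_{t+1})-\nabla\widehat f(\mathbf{x}_t),K)$; $\mathbf{z}_{t+1}=\mathrm{FastMix}\Big(\mathrm{prox}_{\frac{\widehat\gamma}{1+\mu\widehat\gamma}g}\big(\tfrac{1}{1+\mu\widehat\gamma}(\mathbf{z}_t-\widehat\gamma\mathbf{s}_{t+1})\big),K\Big)$; $\mathbf{y}_{t+1}=\mathrm{FastMix}(\widehat\tau\mathbf{z}_{t+1}+(1-\widehat\tau)\mathbf{y}_t,K)$.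 *)

theory Defs
  imports "HOL-Analysis.Analysis"
begin

section \<open>Smooth and strongly convex functions, proximal map\<close>

definition gradient :: "('a::real_inner \<Rightarrow> real) \<Rightarrow> 'a \<Rightarrow> 'a" where
  "gradient f x = (THE D. GDERIV f x :> D)"

definition L_smooth :: "real \<Rightarrow> ('a::real_inner \<Rightarrow> real) \<Rightarrow> bool" where
  "L_smooth L f \<longleftrightarrow>
     (\<forall>x. f differentiable (at x)) \<and>
     (\<forall>x y. f y \<le> f x + gradient f x \<bullet> (y - x) + L / 2 * (norm (x - y))\<^sup>2)"

definition strongly_convex :: "real \<Rightarrow> ('a::real_inner \<Rightarrow> real) \<Rightarrow> bool" where
  "strongly_convex \<mu> f \<longleftrightarrow>
     (\<forall>x. f differentiable (at x)) \<and>
     (\<forall>x y. f y \<ge> f x + gradient f x \<bullet> (y - x) + \<mu> / 2 * (norm (x - y))\<^sup>2)"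

definition prox :: "real \<Rightarrow> (real^'d \<Rightarrow> real) \<Rightarrow> real^'d \<Rightarrow> real^'d" where
  "prox \<gamma> g u = arg_min (\<lambda>w. \<gamma> * g w + 1 / 2 * (norm (w - u))\<^sup>2) (\<lambda>_. True)"

section \<open>Stacked variables\<close>

text \<open>
  An \<open>m \<times> d\<close> matrix is an element of \<^typ>\<open>real^'d^'m\<close> whose \<open>i\<close>-th row
  \<open>x $ i\<close> belongs to agent \<open>i\<close>; its \<^const>\<open>norm\<close> is the Frobenius norm.
\<close>

definition stack :: "real^'d \<Rightarrow> real^'d^'m" where
  "stack u = (\<chi> i. u)"

definition row_mean :: "real^'d^'m \<Rightarrow> real^'d" where
  "row_mean X = (1 / real CARD('m)) *\<^sub>R ((1 :: real^'m) v* X)"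

definition consensus_proj :: "real^'m^'m" where
  "consensus_proj = mat 1 - (1 / real CARD('m)) *\<^sub>R (\<chi> i j. 1)"

definition prox_rows :: "real \<Rightarrow> (real^'d \<Rightarrow> real) \<Rightarrow> real^'d^'m \<Rightarrow> real^'d^'m" where
  "prox_rows \<gamma> g X = (\<chi> i. prox \<gamma> g (X $ i))"

definition grad_hat ::
  "real \<Rightarrow> ('m \<Rightarrow> real^'d \<Rightarrow> real) \<Rightarrow> real^'d^'m \<Rightarrow> real^'d^'m" where
  "grad_hat \<mu> f X = (\<chi> i. gradient (f i) (X $ i) - \<mu> *\<^sub>R (X $ i))"

definition objective ::
  "('m::finite \<Rightarrow> real^'d \<Rightarrow> real) \<Rightarrow> (real^'d \<Rightarrow> real) \<Rightarrow> real^'d \<Rightarrow> real" where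
  "objective f g u = 1 / real CARD('m) * (\<Sum>i\<in>UNIV. f i u) + g u"

section \<open>Network and weight matrix\<close>

text \<open>The edge set of an undirected connected network on all agents; self-loops play no role.\<close>

definition connected_network :: "('m \<times> 'm) set \<Rightarrow> bool" where
  "connected_network E \<longleftrightarrow> sym E \<and> E\<^sup>* = UNIV"

definition pos_semidef :: "real^'m^'m \<Rightarrow> bool" where
  "pos_semidef A \<longleftrightarrow> transpose A = A \<and> (\<forall>v. 0 \<le> v \<bullet> (A *v v))"

definition weight_matrix :: "('m \<times> 'm) set \<Rightarrow> real^'m^'m \<Rightarrow> bool" where
  "weight_matrix E W \<longleftrightarrow>
     transpose W = W \<and>
     (\<forall>i j. W $ i $ j \<noteq> 0 \<longleftrightarrow> (i, j) \<in> E \<or> i = j) \<and>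
     pos_semidef W \<and> pos_semidef (mat 1 - W) \<and>
     W *v 1 = 1 \<and>
     {v. (mat 1 - W) *v v = 0} = span {1}"

definition eigenspace :: "real^'m^'m \<Rightarrow> real \<Rightarrow> (real^'m) set" where
  "eigenspace A c = {v. A *v v = c *\<^sub>R v}"

definition eigenvals :: "real^'m^'m \<Rightarrow> real set" where
  "eigenvals A = {c. \<exists>v. v \<noteq> 0 \<and> A *v v = c *\<^sub>R v}"

text \<open>
  Second entry of the non-increasing list of eigenvalues of a symmetric matrix, repeated according
  to multiplicity: the largest eigenvalue \<open>c\<close> such that at least two eigenvalues, counted with
  multiplicity, are \<open>\<ge> c\<close>. It is meaningful when there are at least two agents; for a single agent
  its value is arbitrary, but then the mixing procedure below is the identity in any case.
\<close>

definition second_largest_eigenval :: "real^'m^'m \<Rightarrow> real" where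
  "second_largest_eigenval A =
     Max {c \<in> eigenvals A. 2 \<le> (\<Sum>c' | c' \<in> eigenvals A \<and> c \<le> c'. dim (eigenspace A c'))}"

section \<open>Accelerated mixing and the algorithm\<close>

definition mix_weight :: "real^'m^'m \<Rightarrow> real" where
  "mix_weight W = 1 / (1 + sqrt (1 - (second_largest_eigenval W)\<^sup>2))"

fun fast_mix :: "real^'m^'m \<Rightarrow> real^'d^'m \<Rightarrow> nat \<Rightarrow> real^'d^'m" where
  "fast_mix W X 0 = X"
| "fast_mix W X (Suc 0) = X"
| "fast_mix W X (Suc (Suc k)) =
     (1 + mix_weight W) *\<^sub>R (W ** fast_mix W X (Suc k)) - mix_weight W *\<^sub>R fast_mix W X k"

text \<open>Iterates are indexed from 1; their values at index 0 are irrelevant.\<close>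

definition modified_ODAPG ::
  "real^'m^'m \<Rightarrow> ('m \<Rightarrow> real^'d \<Rightarrow> real) \<Rightarrow> (real^'d \<Rightarrow> real) \<Rightarrow>
   real \<Rightarrow> real \<Rightarrow> real \<Rightarrow> nat \<Rightarrow> real^'d \<Rightarrow>
   (nat \<Rightarrow> real^'d^'m) \<Rightarrow> (nat \<Rightarrow> real^'d^'m) \<Rightarrow>
   (nat \<Rightarrow> real^'d^'m) \<Rightarrow> (nat \<Rightarrow> real^'d^'m) \<Rightarrow> bool" where
  "modified_ODAPG W f g \<mu> \<gamma> \<tau> K x1 x y z s \<longleftrightarrow>
     x 1 = stack x1 \<and> y 1 = stack x1 \<and> z 1 = stack x1 \<and> s 1 = grad_hat \<mu> f (x 1) \<and>
     (\<forall>t\<ge>1.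
        x (Suc t) = \<tau> *\<^sub>R z t + (1 - \<tau>) *\<^sub>R y t \<and>
        s (Suc t) = fast_mix W (s t + grad_hat \<mu> f (x (Suc t)) - grad_hat \<mu> f (x t)) K \<and>
        z (Suc t) = fast_mix W
          (prox_rows (\<gamma> / (1 + \<mu> * \<gamma>)) g
             ((1 / (1 + \<mu> * \<gamma>)) *\<^sub>R (z t - \<gamma> *\<^sub>R s (Suc t)))) K \<and>
        y (Suc t) = fast_mix W (\<tau> *\<^sub>R z (Suc t) + (1 - \<tau>) *\<^sub>R y t) K)"

end

theory Submission
  imports Defs
begin

text \<open>
  Write \<open>l = L - \<mu>\<close> and move \<open>\<mu>/2 * |u|^2\<close> from every \<open>f i\<close> to \<open>g\<close>. The smooth parts
  \<open>\<phi> i = f i - \<mu>/2 * |.|^2\<close> are then convex and \<open>l\<close>-smooth, the non-smooth part \<open>h\<close> is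
  strongly convex, and the objective is unchanged. The network never changes a row mean
  (\<open>row_mean_fast_mix\<close>), so by gradient tracking the mean of \<open>s (t+1)\<close> is exactly the mean of
  the local gradients at the rows of \<open>x (t+1)\<close>. Hence the row means perform an accelerated
  proximal gradient step on the objective itself, with a gradient that is inexact only because
  the rows of \<open>x (t+1)\<close> differ (\<open>accelerated_prox_step\<close>). The claim follows by combining
  the usual potential \<open>2m/\<mu> * (F - F*) + (1 + \<tau>) * m * |z - x*|^2\<close> of the means with
  the squared deviations from consensus.

  \<^bold>\<open>Mixing.\<close> One call of the mixing procedure reduces every squared deviation from consensus by
  the factor 8 (\<open>fast_mix_consensus_contraction\<close>). In an orthonormal basis of eigenvectors of
  \<open>W\<close> the procedure is a scalar two-term recursion whose coefficients make the characteristic roots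
  non-real of modulus \<open>(1 + s)^(-1/2)\<close>, with \<open>s = sqrt (1 - \<lambda>\<^sub>2^2)\<close>; with \<open>K \<ge> 11 / s\<close> this
  beats the bounded transient factor.

  \<^bold>\<open>Deviation of the prox output.\<close> The step inequality, applied to the stacked prox
  output \<open>p\<close>, contains the full distance \<open>|p - 1 x*|^2\<close>, which exceeds the distance of
  the mean by \<open>|\<Pi> p|^2\<close>. This surplus absorbs the error term
  \<open>\<langle>\<Pi> s, \<Pi> p\<rangle>\<close>, and after mixing it controls the new deviation of \<open>z\<close>.

  \<^bold>\<open>Deviation of the tracked gradient.\<close> It is fed by the change of the gradient from
  \<open>x t\<close> to \<open>x (t+1)\<close>. Bounding this by the distance of the two points would produce an error
  proportional to the whole potential, which the contraction by \<open>1 - \<tau>/2\<close> cannot absorb. Instead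
  the change is split at the consensual point \<open>mean (y t)\<close>. From there to \<open>x (t+1)\<close> it is paid
  for by the Bregman gap that cocoercivity adds to the convexity inequality at \<open>mean (y t)\<close>. From
  \<open>x t\<close> to there it is Lipschitz small, because \<open>mean (y t) - mean (x t)\<close> equals
  \<open>\<tau> * (mean (z t) - mean (z (t-1)))\<close> and the step inequality also controls that movement.

  After scaling by \<open>\<gamma>\<close> and \<open>\<tau>\<close> all error terms obey a linear system with numerical
  coefficients (\<open>lyapunov_contraction\<close>), so the potential decreases by the factor
  \<open>1 - \<tau>/2\<close> in every step. The exponent \<open>T\<close> for \<open>T - 1\<close> steps is gained at the start,
  from strong convexity of the objective (\<open>linear_convergence\<close>).
\<close>

section \<open>Spectral decomposition of self-adjoint operators\<close>

text \<open>
  The form \<open>c * |u|^2 - u \<bullet> f u\<close> is nonnegative on \<open>S\<close> and vanishes at the maximizer \<open>v\<close>,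
  so its derivative at \<open>v\<close> vanishes in every direction of \<open>S\<close>. The residual
  \<open>w = c v - f v\<close> is such a direction, and the derivative there is \<open>2 * |w|^2\<close>.
\<close>

lemma rayleigh_maximizer_is_eigenvector:
  fixes f :: "'a::euclidean_space \<Rightarrow> 'a"
  assumes lin: "linear f" and self: "\<And>u v. f u \<bullet> v = u \<bullet> f v"
    and S: "subspace S" and inv: "\<And>u. u \<in> S \<Longrightarrow> f u \<in> S"
    and v: "v \<in> S" "norm v = 1"
    and max: "\<And>u. u \<in> S \<Longrightarrow> norm u = 1 \<Longrightarrow> u \<bullet> f u \<le> v \<bullet> f v"
  shows "f v = (v \<bullet> f v) *\<^sub>R v"
proof -
  define c where "c = v \<bullet> f v"
  have quad: "u \<bullet> f u \<le> c * (u \<bullet> u)" if "u \<in> S" for u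
  proof (cases "u = 0")
    case False
    define e where "e = (1 / norm u) *\<^sub>R u"
    have e: "e \<in> S" "norm e = 1"
      using that S False by (auto simp: e_def subspace_scale)
    have u: "u = norm u *\<^sub>R e"
      using False by (simp add: e_def)
    have "u \<bullet> f u = (norm u)\<^sup>2 * (e \<bullet> f e)"
      by (subst (1 2) u) (simp add: linear_cmul[OF lin] power2_eq_square)
    also have "\<dots> \<le> (norm u)\<^sup>2 * c"
      using max[OF e] by (simp add: c_def mult_left_mono)
    finally show ?thesis
      by (simp add: power2_norm_eq_inner mult.commute)
  qed (simp add: linear_0[OF lin])
  define w where "w = c *\<^sub>R v - f v"
  have w: "w \<in> S"
    using S inv v by (simp add: w_def subspace_diff subspace_scale)
  define q where "q = c * (w \<bullet> w) - w \<bullet> f w"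
  have var: "0 \<le> 2 * t * (w \<bullet> w) + t\<^sup>2 * q" for t :: real
  proof -
    have "v + t *\<^sub>R w \<in> S"
      using S v w by (simp add: subspace_add subspace_scale)
    then have "0 \<le> c * ((v + t *\<^sub>R w) \<bullet> (v + t *\<^sub>R w)) - (v + t *\<^sub>R w) \<bullet> f (v + t *\<^sub>R w)"
      using quad by fastforce
    also have "\<dots> = 2 * t * (w \<bullet> w) + t\<^sup>2 * q"
    proof -
      have 1: "v \<bullet> v = 1"
        using v(2) by (simp add: norm_eq_1)
      have 2: "v \<bullet> f w = f v \<bullet> w" "w \<bullet> f v = f v \<bullet> w"
        using self by (simp_all add: inner_commute)
      have 3: "w \<bullet> w = c * (v \<bullet> w) - f v \<bullet> w"
        by (metis inner_diff_left inner_scaleR_left w_def)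
      have 4: "v \<bullet> f v = c" "w \<bullet> v = v \<bullet> w"
        by (auto simp: c_def inner_commute)
      have "c * ((v + t *\<^sub>R w) \<bullet> (v + t *\<^sub>R w)) - (v + t *\<^sub>R w) \<bullet> f (v + t *\<^sub>R w)
        = 2 * t * (c * (v \<bullet> w) - f v \<bullet> w) + t\<^sup>2 * q"
        unfolding q_def
        by (simp add: linear_add[OF lin] linear_cmul[OF lin] inner_add_left inner_add_right
            1 2 4 algebra_simps power2_eq_square)
      then show ?thesis
        using 3 by simp
    qed
    finally show ?thesis .
  qed
  have "w \<bullet> w = 0"
  proof (rule ccontr)
    assume "w \<bullet> w \<noteq> 0"
    then have pos: "w \<bullet> w > 0"
      by simp
    \<comment> \<open>A short step against \<open>w\<close>: the quadratic term cannot outweigh the linear one.\<close>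
    define t where "t = - (w \<bullet> w) / (\<bar>q\<bar> + 1)"
    have "t < 0"
      using pos by (simp add: t_def divide_neg_pos)
    then have "2 * (w \<bullet> w) + t * q \<le> 0"
      using var[of t] zero_le_mult_iff[of t "2 * (w \<bullet> w) + t * q"]
      by (simp add: power2_eq_square ring_distribs mult.assoc mult.left_commute)
    moreover have "t * q \<ge> - (w \<bullet> w)"
    proof -
      have "- (w \<bullet> w) = (w \<bullet> w) * (- 1)"
        by simp
      also have "\<dots> \<le> (w \<bullet> w) * (- q / (\<bar>q\<bar> + 1))"
        using pos by (intro mult_left_mono) (auto simp: divide_simps)
      finally show ?thesis by (simp add: t_def)
    qed
    ultimately show False
      using pos by linarith
  qed
  then show ?thesis
    by (simp add: w_def c_def)
qed

lemma exists_eigenvector_in_invariant_subspace: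
  fixes f :: "'a::euclidean_space \<Rightarrow> 'a"
  assumes lin: "linear f" and self: "\<And>u v. f u \<bullet> v = u \<bullet> f v"
    and S: "subspace S" and inv: "\<And>u. u \<in> S \<Longrightarrow> f u \<in> S" and ne: "S \<noteq> {0}"
  obtains v c where "v \<in> S" "norm v = 1" "f v = c *\<^sub>R v"
proof -
  have "compact (S \<inter> sphere 0 1)"
    by (rule closed_Int_compact[OF closed_subspace[OF S] compact_sphere])
  moreover have "S \<inter> sphere 0 1 \<noteq> {}"
  proof -
    obtain u where "u \<in> S" "u \<noteq> 0"
      using ne S subspace_0 by blast
    then have "(1 / norm u) *\<^sub>R u \<in> S \<inter> sphere 0 1"
      using S by (simp add: subspace_scale)
    then show ?thesis by blast
  qed
  moreover have "continuous_on (S \<inter> sphere 0 1) (\<lambda>u. u \<bullet> f u)"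
    using lin by (intro continuous_on_inner continuous_on_id linear_continuous_on)
      (simp add: linear_conv_bounded_linear)
  ultimately obtain v where v: "v \<in> S \<inter> sphere 0 1"
    "\<And>u. u \<in> S \<inter> sphere 0 1 \<Longrightarrow> u \<bullet> f u \<le> v \<bullet> f v"
    using continuous_attains_sup[of "S \<inter> sphere 0 1" "\<lambda>u. u \<bullet> f u"] by blast
  then have "f v = (v \<bullet> f v) *\<^sub>R v"
    by (intro rayleigh_maximizer_is_eigenvector[OF lin self S inv]) auto
  with v that show thesis by auto
qed

text \<open>
  Spectral theorem on an invariant subspace. The subspace is needed because mixing contracts only
  on the orthogonal complement of the all-ones vector. Induction on the dimension: split off one
  eigenvector; its orthogonal complement in \<open>S\<close> is invariant since \<open>f\<close> is self-adjoint.
\<close>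

proposition orthonormal_eigenbasis_exists:
  fixes f :: "'a::euclidean_space \<Rightarrow> 'a"
  assumes lin: "linear f" and self: "\<And>u v. f u \<bullet> v = u \<bullet> f v"
    and "subspace S" and "\<And>u. u \<in> S \<Longrightarrow> f u \<in> S"
  shows "\<exists>B. finite B \<and> pairwise orthogonal B \<and> (\<forall>b\<in>B. norm b = 1 \<and> (\<exists>c. f b = c *\<^sub>R b)) \<and> span B = S"
  using assms(3,4)
proof (induction "dim S" arbitrary: S rule: less_induct)
  case less
  show ?case
  proof (cases "S = {0}")
    case True
    then show ?thesis
      by (intro exI[of _ "{}"]) auto
  next
    case False
    then obtain v c where v: "v \<in> S" "norm v = 1" "f v = c *\<^sub>R v"
      using exists_eigenvector_in_invariant_subspace[OF lin self less.prems] by blast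
    define S' where "S' = {u \<in> S. v \<bullet> u = 0}"
    have S': "subspace S'"
      using less.prems(1) unfolding S'_def subspace_def by (auto simp: inner_add_right)
    have "dim S' < dim S"
    proof (rule dim_psubset)
      have "v \<notin> S'"
        using v by (auto simp: S'_def norm_eq_1)
      moreover have "S' \<subseteq> S"
        by (auto simp: S'_def)
      ultimately show "span S' \<subset> span S"
        using v(1) less.prems(1) S' by (metis psubsetI span_eq_iff)
    qed
    moreover have "f u \<in> S'" if "u \<in> S'" for u
      using that less.prems(2) v(3) self[of v u] by (auto simp: S'_def)
    ultimately obtain B where B: "finite B" "pairwise orthogonal B"
      "\<forall>b\<in>B. norm b = 1 \<and> (\<exists>c. f b = c *\<^sub>R b)" "span B = S'"
      using less.hyps[of S'] S' by blast
    have orth: "orthogonal v b" if "b \<in> B" for b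
      using that B(4) span_base[of b B] by (auto simp: S'_def orthogonal_def)
    have "span (insert v B) = S"
    proof
      show "span (insert v B) \<subseteq> S"
        using v(1) B(4) less.prems(1) span_superset[of B]
        by (intro span_minimal) (auto simp: S'_def)
      show "S \<subseteq> span (insert v B)"
      proof
        fix u assume u: "u \<in> S"
        have "u - (v \<bullet> u) *\<^sub>R v \<in> S'"
          using u v less.prems(1)
          by (simp add: S'_def subspace_diff subspace_scale inner_diff_right norm_eq_1)
        then show "u \<in> span (insert v B)"
          using B(4) span_breakdown_eq by blast
      qed
    qed
    moreover have "pairwise orthogonal (insert v B)"
      using B(2) orth by (simp add: pairwise_insert orthogonal_commute)
    ultimately show ?thesis
      using B v by (intro exI[of _ "insert v B"]) auto
  qed
qed

lemma parseval_in_span: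
  fixes v :: "'a::euclidean_space"
  assumes "pairwise orthogonal B" "\<And>b. b \<in> B \<Longrightarrow> norm b = 1" "finite B" "v \<in> span B"
  shows "(norm v)\<^sup>2 = (\<Sum>b\<in>B. (b \<bullet> v)\<^sup>2)"
proof -
  have "v \<bullet> v = (\<Sum>b\<in>B. (v \<bullet> b) *\<^sub>R b) \<bullet> v"
    by (subst orthonormal_basis_expand) (use assms in auto)
  also have "\<dots> = (\<Sum>b\<in>B. (v \<bullet> b) * (b \<bullet> v))"
    by (simp add: inner_sum_left)
  also have "\<dots> = (\<Sum>b\<in>B. (b \<bullet> v)\<^sup>2)"
    by (intro sum.cong refl) (simp add: power2_eq_square inner_commute)
  finally show ?thesis
    by (simp add: power2_norm_eq_inner)
qed

section \<open>Row means and deviations from consensus\<close>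

lemma row_mean_eq: "row_mean X = (1 / real CARD('m)) *\<^sub>R (\<Sum>i\<in>UNIV. X $ i)"
  for X :: "real^'d^'m"
  by (simp add: row_mean_def vector_matrix_mult_def vec_eq_iff)

lemma consensus_proj_mult: "consensus_proj ** X = X - stack (row_mean X)"
  for X :: "real^'d^'m"
proof -
  have "(mat 1 :: real^'m^'m) ** X = X"
    by simp
  moreover have "((1 / real CARD('m)) *\<^sub>R (\<chi> i j. 1) :: real^'m^'m) ** X = stack (row_mean X)"
    by (simp add: vec_eq_iff matrix_matrix_mult_def stack_def row_mean_eq sum_distrib_left)
  ultimately show ?thesis
    by (simp add: consensus_proj_def matrix_matrix_mult_def vec_eq_iff algebra_simps sum_subtractf)
qed

lemma vector_matrix_stack: "b v* stack u = (b \<bullet> 1) *\<^sub>R u"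
  for b :: "real^'m"
  by (simp add: vec_eq_iff vector_matrix_mult_def stack_def inner_vec_def sum_distrib_right)

section \<open>Accelerated mixing contracts deviations from consensus\<close>

text \<open>The factor by which accelerated mixing scales the component along an eigenvector with eigenvalue \<open>\<nu>\<close>.\<close>

fun mix_factor :: "real \<Rightarrow> real \<Rightarrow> nat \<Rightarrow> real" where
  "mix_factor \<eta> \<nu> 0 = 1"
| "mix_factor \<eta> \<nu> (Suc 0) = 1"
| "mix_factor \<eta> \<nu> (Suc (Suc k)) = (1 + \<eta>) * \<nu> * mix_factor \<eta> \<nu> (Suc k) - \<eta> * mix_factor \<eta> \<nu> k"

text \<open>
  For roots \<open>r, r'\<close> of the characteristic polynomial \<open>X^2 - (1 + \<eta>) \<nu> X + \<eta>\<close> the left-hand side is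
  \<open>(a' - r a) (a' - r' a)\<close> for consecutive values \<open>a, a'\<close>, and each recursion step multiplies it by
  \<open>r r' = \<eta>\<close>. This yields the decay rate without computing complex roots.
\<close>

lemma mix_factor_quadratic_invariant:
  "(mix_factor \<eta> \<nu> (Suc k))\<^sup>2 - (1 + \<eta>) * \<nu> * mix_factor \<eta> \<nu> (Suc k) * mix_factor \<eta> \<nu> k
    + \<eta> * (mix_factor \<eta> \<nu> k)\<^sup>2 = \<eta> ^ k * ((1 + \<eta>) * (1 - \<nu>))"
proof (induction k)
  case (Suc k)
  define p q where "p = mix_factor \<eta> \<nu> (Suc k)" and "q = mix_factor \<eta> \<nu> k"
  have "((1 + \<eta>) * \<nu> * p - \<eta> * q)\<^sup>2 - (1 + \<eta>) * \<nu> * ((1 + \<eta>) * \<nu> * p - \<eta> * q) * p + \<eta> * p\<^sup>2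
    = \<eta> * (p\<^sup>2 - (1 + \<eta>) * \<nu> * p * q + \<eta> * q\<^sup>2)"
    by algebra
  then show ?case
    using Suc.IH by (simp add: p_def q_def)
qed (simp add: algebra_simps)

lemma mix_factor_at_one: "mix_factor \<eta> 1 k = 1"
  by (induction k rule: induct_nat_012) auto

text \<open>
  Completing the square, the invariant form dominates a multiple of the square of the last value.
  That multiple can be arbitrarily small when \<open>\<nu>\<close> is close to \<open>1\<close>, but so is then the initial
  value of the form, which contains the factor \<open>1 - \<nu>\<close>; the gap assumption compares the two.
\<close>

lemma mix_factor_le:
  assumes "\<eta> > 0" "\<nu> < 1" and gap: "3 / 4 * (1 - \<nu>) \<le> 1 - ((1 + \<eta>) * \<nu>)\<^sup>2 / (4 * \<eta>)"
  shows "(mix_factor \<eta> \<nu> (Suc k))\<^sup>2 \<le> 4 / 3 * (1 + \<eta>) * \<eta> ^ k"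
proof -
  define p q a where "p = mix_factor \<eta> \<nu> (Suc k)" and "q = mix_factor \<eta> \<nu> k" and "a = (1 + \<eta>) * \<nu>"
  have "3 / 4 * (1 - \<nu>) * p\<^sup>2 \<le> (1 - a\<^sup>2 / (4 * \<eta>)) * p\<^sup>2"
    using gap by (intro mult_right_mono) (auto simp: a_def)
  also have "\<dots> \<le> (1 - a\<^sup>2 / (4 * \<eta>)) * p\<^sup>2 + \<eta> * (q - a * p / (2 * \<eta>))\<^sup>2"
    using \<open>\<eta> > 0\<close> by simp
  also have "\<dots> = p\<^sup>2 - a * p * q + \<eta> * q\<^sup>2"
    using \<open>\<eta> > 0\<close> by (simp add: power2_eq_square field_simps)
  also have "\<dots> = \<eta> ^ k * ((1 + \<eta>) * (1 - \<nu>))"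
    using mix_factor_quadratic_invariant[of \<eta> \<nu> k] by (simp add: p_def q_def a_def)
  also have "\<dots> = 3 / 4 * (1 - \<nu>) * (4 / 3 * (1 + \<eta>) * \<eta> ^ k)"
    by (simp add: field_simps)
  finally have "3 / 4 * (1 - \<nu>) * p\<^sup>2 \<le> 3 / 4 * (1 - \<nu>) * (4 / 3 * (1 + \<eta>) * \<eta> ^ k)" .
  then show ?thesis
    using \<open>\<nu> < 1\<close> by (simp add: p_def)
qed

text \<open>
  With \<open>k = (1 + \<eta>)^2 / (4 \<eta>)\<close> the claim is \<open>k \<nu>^2 \<le> 1/4 + 3/4 \<nu>\<close>. Its left side is
  convex in \<open>\<nu>\<close> and its right side is linear, so the end points \<open>0\<close> and \<open>c\<close> suffice. At \<open>c\<close>,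
  \<open>s^2 = 1 - c^2\<close> gives \<open>k c^2 = 1 - 3/4 s^2 - s^3/4\<close>, where \<open>s^2 \<ge> 1 - c\<close>.
\<close>

lemma mix_weight_spectral_gap:
  fixes c \<nu> :: real
  assumes "0 \<le> \<nu>" "\<nu> \<le> c" "c < 1"
  defines "\<eta> \<equiv> 1 / (1 + sqrt (1 - c\<^sup>2))"
  shows "3 / 4 * (1 - \<nu>) \<le> 1 - ((1 + \<eta>) * \<nu>)\<^sup>2 / (4 * \<eta>)"
proof -
  define s where "s = sqrt (1 - c\<^sup>2)"
  have c: "0 \<le> c" "c\<^sup>2 \<le> c"
    using assms by (auto simp: power2_eq_square mult_left_le)
  then have s2: "s\<^sup>2 = 1 - c\<^sup>2" and s: "s \<ge> 0"
    using \<open>c < 1\<close> by (auto simp: s_def)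
  define k where "k = (2 + s)\<^sup>2 / (4 * (1 + s))"
  have eta: "\<eta> = 1 / (1 + s)"
    by (simp add: \<eta>_def s_def)
  have k: "((1 + \<eta>) * \<nu>)\<^sup>2 / (4 * \<eta>) = k * \<nu>\<^sup>2"
  proof -
    have "1 + \<eta> = (2 + s) / (1 + s)" "4 * \<eta> = 4 / (1 + s)"
      using s by (simp_all add: eta field_simps)
    then show ?thesis
      using s by (simp add: k_def power_mult_distrib power_divide power2_eq_square ac_simps)
  qed
  have kc: "k * c\<^sup>2 \<le> 1 / 4 + 3 / 4 * c"
  proof -
    have "c\<^sup>2 = (1 + s) * (1 - s)"
      using s2 by (simp add: algebra_simps power2_eq_square)
    then have "k * c\<^sup>2 = (2 + s)\<^sup>2 * (1 - s) / 4"
      using s by (simp add: k_def divide_simps) (simp add: algebra_simps)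
    also have "\<dots> = 1 - 3 / 4 * s\<^sup>2 - s ^ 3 / 4"
      by (simp add: field_simps power2_eq_square power3_eq_cube)
    also have "\<dots> \<le> 1 - 3 / 4 * (1 - c)"
      using s2 c(2) zero_le_power[OF s, of 3] by argo
    finally show ?thesis by argo
  qed
  have "\<nu> * (k * c - 3 / 4) \<le> 1 / 4"
  proof (cases "k * c \<le> 3 / 4")
    case True
    then have "\<nu> * (k * c - 3 / 4) \<le> 0"
      using assms(1) by (simp add: mult_nonneg_nonpos)
    then show ?thesis by simp
  next
    case False
    then have "\<nu> * (k * c - 3 / 4) \<le> c * (k * c - 3 / 4)"
      using assms(2) by (intro mult_right_mono) auto
    then show ?thesis
      using kc by (simp add: power2_eq_square algebra_simps)
  qed
  moreover have "k * \<nu>\<^sup>2 \<le> \<nu> * (k * c)"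
  proof -
    have "k * \<nu>\<^sup>2 = \<nu> * (k * \<nu>)"
      by (simp add: power2_eq_square)
    also have "\<dots> \<le> \<nu> * (k * c)"
      using assms(1,2) s by (intro mult_left_mono) (auto simp: k_def)
    finally show ?thesis .
  qed
  ultimately show ?thesis
    unfolding k right_diff_distrib by argo
qed

lemma one_plus_power_ge_32:
  fixes s :: real
  assumes "0 < s" "s \<le> 1" "10 / s \<le> real K"
  shows "32 \<le> (1 + s) ^ K"
proof -
  define n where "n = nat \<lceil>1 / s\<rceil>"
  have n: "1 / s \<le> real n" "real n \<le> 1 / s + 1"
    using \<open>0 < s\<close> by (auto simp: n_def)
  have "1 \<le> 1 / s"
    using assms by simp
  then have "5 * real n \<le> real K"
    using n(2) assms(3) by (simp add: field_simps)
  then have "5 * n \<le> K"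
    by linarith
  have "2 \<le> 1 + real n * s"
    using n(1) \<open>0 < s\<close> by (simp add: field_simps)
  also have "\<dots> \<le> (1 + s) ^ n"
    using \<open>0 < s\<close> by (intro Bernoulli_inequality) auto
  finally have "2 ^ 5 \<le> ((1 + s) ^ n) ^ 5"
    by (intro power_mono) auto
  also have "\<dots> = (1 + s) ^ (5 * n)"
    by (simp add: power_mult[symmetric] mult.commute)
  also have "\<dots> \<le> (1 + s) ^ K"
    using \<open>5 * n \<le> K\<close> \<open>0 < s\<close> by (intro power_increasing) auto
  finally show ?thesis by simp
qed

text \<open>
  Here \<open>\<eta> = 1 / (1 + s)\<close> with \<open>s = sqrt (1 - c^2) \<ge> sqrt (1 - c)\<close>, hence \<open>K \<ge> 11 / s\<close>. The
  transient factor, including the index shift from \<open>k\<close> to \<open>K = k + 1\<close>, is at most \<open>4\<close>, and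
  \<open>\<eta>^K \<le> 1/32\<close> by Bernoulli's inequality.
\<close>

lemma mix_factor_small:
  fixes c \<nu> :: real
  assumes "0 \<le> \<nu>" "\<nu> \<le> c" "c < 1" and K: "11 / sqrt (1 - c) \<le> real K"
  shows "(mix_factor (1 / (1 + sqrt (1 - c\<^sup>2))) \<nu> K)\<^sup>2 \<le> 1 / 8"
proof -
  define s where "s = sqrt (1 - c\<^sup>2)"
  have c: "0 \<le> c" "c\<^sup>2 \<le> c"
    using assms by (auto simp: power2_eq_square mult_left_le)
  then have s: "0 < s" "s \<le> 1" "sqrt (1 - c) \<le> s"
    using \<open>c < 1\<close> by (auto simp: s_def abs_square_less_1)
  have "10 / s \<le> 11 / sqrt (1 - c)"
    using s \<open>c < 1\<close> by (intro frac_le) auto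
  then have K': "10 / s \<le> real K"
    using K by linarith
  then have big: "32 \<le> (1 + s) ^ K"
    using s one_plus_power_ge_32 by blast
  have "K \<noteq> 0"
    using K' s divide_pos_pos[of 10 s] by (intro notI) simp
  then obtain k where k: "K = Suc k"
    using not0_implies_Suc by blast
  have "(mix_factor (1 / (1 + s)) \<nu> K)\<^sup>2 \<le> 4 / 3 * (1 + 1 / (1 + s)) * (1 / (1 + s)) ^ k"
    unfolding k s_def
    using assms s by (intro mix_factor_le mix_weight_spectral_gap) (auto simp: s_def add_pos_nonneg)
  also have "\<dots> = 4 / 3 * (2 + s) / (1 + s) ^ K"
    using s by (simp add: k field_simps)
  also have "\<dots> \<le> 4 / (1 + s) ^ K"
    using s by (intro divide_right_mono) auto
  also have "\<dots> \<le> 4 / 32"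
    using big s by (intro divide_left_mono) auto
  finally show ?thesis by (simp add: s_def)
qed

lemma eigenvector_mult_fast_mix:
  fixes W :: "real^'m^'m" and X :: "real^'d^'m"
  assumes "transpose W = W" "W *v b = \<nu> *\<^sub>R b"
  shows "b v* fast_mix W X k = mix_factor (mix_weight W) \<nu> k *\<^sub>R (b v* X)"
proof -
  have left: "b v* (W ** Y) = \<nu> *\<^sub>R (b v* Y)" for Y :: "real^'d^'m"
    by (metis assms scaleR_vector_matrix_assoc transpose_matrix_vector vector_matrix_mul_assoc)
  show ?thesis
    by (induction k rule: induct_nat_012)
      (simp_all add: left vector_matrix_mult_diff_distrib vector_scaleR_matrix_ac scaleR_vector_matrix_assoc[symmetric] algebra_simps)
qed

lemma row_mean_fast_mix:
  assumes "transpose W = W" "W *v 1 = 1"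
  shows "row_mean (fast_mix W X k) = row_mean X"
  using eigenvector_mult_fast_mix[OF assms(1), of 1 1 X k] assms(2)
  by (simp add: row_mean_def mix_factor_at_one)

text \<open>
  Together with the simple eigenvalue \<open>1\<close> of the all-ones vector, \<open>\<nu>\<close> makes two eigenvalues that
  are at least \<open>\<nu>\<close>, so \<open>\<nu>\<close> competes in the maximum that defines the second largest eigenvalue. The value \<open>1\<close> does
  not compete, because its eigenspace is one-dimensional and no eigenvalue is larger. The existence
  of \<open>v\<close> guarantees at least two agents.
\<close>

lemma weight_matrix_second_eigenvalue:
  fixes W :: "real^'m^'m"
  assumes W: "weight_matrix E W" and v: "v \<noteq> 0" "v \<bullet> 1 = 0" "W *v v = \<nu> *\<^sub>R v"
  shows "0 \<le> \<nu>" "\<nu> \<le> second_largest_eigenval W" "second_largest_eigenval W < 1"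
proof -
  have tr: "transpose W = W" and one: "W *v 1 = 1"
    and psd: "pos_semidef W" "pos_semidef (mat 1 - W)"
    and ker: "{u. (mat 1 - W) *v u = 0} = span {1}"
    using W by (auto simp: weight_matrix_def)
  have self: "(W *v u) \<bullet> w = u \<bullet> (W *v w)" for u w
    by (metis dot_lmul_matrix tr transpose_matrix_vector)
  have fix1: "W *v u = u \<longleftrightarrow> u \<in> span {1}" for u
  proof -
    have "W *v u = u \<longleftrightarrow> u \<in> {u. (mat 1 - W) *v u = 0}"
      by (auto simp: matrix_vector_mult_diff_rdistrib)
    then show ?thesis
      using ker by simp
  qed
  have ev: "0 \<le> c \<and> c \<le> 1" if u: "u \<noteq> 0" "W *v u = c *\<^sub>R u" for c u
  proof -
    have "0 \<le> u \<bullet> (W *v u)" "0 \<le> u \<bullet> ((mat 1 - W) *v u)"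
      using psd by (auto simp: pos_semidef_def)
    then have "0 \<le> c * (u \<bullet> u)" "0 \<le> (1 - c) * (u \<bullet> u)"
      by (simp_all add: u(2) matrix_vector_mult_diff_rdistrib inner_diff_right left_diff_distrib)
    moreover have "0 < u \<bullet> u"
      using u(1) by simp
    ultimately show ?thesis
      by (simp add: zero_le_mult_iff)
  qed
  have "\<exists>B. finite B \<and> pairwise orthogonal B \<and> (\<forall>b\<in>B. norm b = 1 \<and> (\<exists>c. W *v b = c *\<^sub>R b))
      \<and> span B = UNIV"
    using self by (intro orthonormal_eigenbasis_exists) auto
  then obtain B where B: "finite B" "\<And>b. b \<in> B \<Longrightarrow> \<exists>c. W *v b = c *\<^sub>R b" "span B = UNIV"
    by blast
  define ev_of where "ev_of b = (SOME c. W *v b = c *\<^sub>R b)" for b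
  have "eigenvals W \<subseteq> ev_of ` B"
  proof
    fix c assume "c \<in> eigenvals W"
    then obtain u where u: "u \<noteq> 0" "W *v u = c *\<^sub>R u"
      by (auto simp: eigenvals_def)
    obtain b where b: "b \<in> B" "b \<bullet> u \<noteq> 0"
      using u(1) orthogonal_to_span[of u B u] B(3)
      by (metis UNIV_I inner_commute orthogonal_def orthogonal_self)
    have "W *v b = ev_of b *\<^sub>R b"
      unfolding ev_of_def using B(2)[OF b(1)] by (rule someI_ex)
    then have "ev_of b * (b \<bullet> u) = c * (b \<bullet> u)"
      using self[of b u] u(2) by simp
    then show "c \<in> ev_of ` B"
      using b by auto
  qed
  then have fin: "finite (eigenvals W)"
    using B(1) finite_surj by blast
  define C where "C = {c \<in> eigenvals W. 2 \<le> (\<Sum>c' | c' \<in> eigenvals W \<and> c \<le> c'. dim (eigenspace W c'))}"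
  have Max: "second_largest_eigenval W = Max C"
    by (simp add: second_largest_eigenval_def C_def)
  have dim_pos: "1 \<le> dim (eigenspace W c)" if u: "u \<noteq> 0" "W *v u = c *\<^sub>R u" for c u
  proof -
    have "dim (eigenspace W c) \<noteq> 0"
      using u by (auto simp: eigenspace_def dim_eq_0)
    then show ?thesis by linarith
  qed
  have one_nz: "(1::real^'m) \<noteq> 0"
    by (simp add: vec_eq_iff)
  have "\<nu> \<noteq> 1"
  proof
    assume "\<nu> = 1"
    then have "v \<in> span {1}"
      using fix1 v(3) by simp
    then obtain k where "v = k *\<^sub>R 1"
      by (auto simp: span_singleton)
    then show False
      using v(1,2) by auto
  qed
  have "\<nu> \<in> C"
  proof -
    have mem: "\<nu> \<in> eigenvals W" "1 \<in> eigenvals W"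
      unfolding eigenvals_def using v one one_nz by (auto intro: exI[of _ "1::real^'m"])
    have "2 \<le> (\<Sum>c'\<in>{\<nu>, 1}. dim (eigenspace W c'))"
      using dim_pos[OF v(1,3)] dim_pos[of 1 1] one one_nz \<open>\<nu> \<noteq> 1\<close> by simp
    also have "\<dots> \<le> (\<Sum>c' | c' \<in> eigenvals W \<and> \<nu> \<le> c'. dim (eigenspace W c'))"
      using fin mem ev[OF v(1,3)] by (intro sum_mono2) auto
    finally show ?thesis
      using mem by (simp add: C_def)
  qed
  have "finite C"
    using fin by (simp add: C_def)
  then have max_in: "Max C \<in> C" and "\<nu> \<le> Max C"
    using \<open>\<nu> \<in> C\<close> Max_in by auto
  then show "\<nu> \<le> second_largest_eigenval W" "0 \<le> \<nu>"
    using ev[OF v(1,3)] Max by auto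
  have CD: "c \<in> eigenvals W" "2 \<le> (\<Sum>c' | c' \<in> eigenvals W \<and> c \<le> c'. dim (eigenspace W c'))"
    if "c \<in> C" for c
    using that by (auto simp: C_def)
  obtain u where u: "u \<noteq> 0" "W *v u = Max C *\<^sub>R u"
    using CD(1)[OF max_in] unfolding eigenvals_def by blast
  have "Max C \<noteq> 1"
  proof
    assume eq: "Max C = 1"
    have "{c' \<in> eigenvals W. 1 \<le> c'} \<subseteq> {1}"
      using ev unfolding eigenvals_def by (auto intro: antisym)
    then have "(\<Sum>c' | c' \<in> eigenvals W \<and> 1 \<le> c'. dim (eigenspace W c')) \<le> (\<Sum>c'\<in>{1}. dim (eigenspace W c'))"
      by (intro sum_mono2) auto
    moreover have "eigenspace W 1 = span {1}"
      using fix1 by (auto simp: eigenspace_def)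
    moreover have "dim (span {1 :: real^'m}) \<le> 1"
      using dim_le_card[of "{1 :: real^'m}"] by simp
    ultimately show False
      using CD(2)[OF max_in] unfolding eq by simp
  qed
  then show "second_largest_eigenval W < 1"
    using ev[OF u] Max by simp
qed

text \<open>
  By Parseval in an eigenbasis of the complement of the all-ones vector, the squared deviation is
  the sum of the squared components, and each component is scaled by its \<^const>\<open>mix_factor\<close>.
  With a single agent the eigenbasis is empty and both sides vanish.
\<close>

lemma fast_mix_consensus_contraction:
  fixes W :: "real^'m^'m" and X :: "real^'d^'m"
  assumes W: "weight_matrix E W" and K: "11 / sqrt (1 - second_largest_eigenval W) \<le> real K"
  shows "(norm (consensus_proj ** fast_mix W X K))\<^sup>2 \<le> 1 / 8 * (norm (consensus_proj ** X))\<^sup>2"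
proof -
  have tr: "transpose W = W" and one: "W *v 1 = 1"
    using W by (auto simp: weight_matrix_def)
  have self: "(W *v u) \<bullet> w = u \<bullet> (W *v w)" for u w
    by (metis dot_lmul_matrix tr transpose_matrix_vector)
  define S where "S = {v :: real^'m. v \<bullet> 1 = 0}"
  have "subspace S"
    by (simp add: S_def subspace_def inner_add_left)
  then have "\<exists>B. finite B \<and> pairwise orthogonal B \<and> (\<forall>b\<in>B. norm b = 1 \<and> (\<exists>c. W *v b = c *\<^sub>R b))
      \<and> span B = S"
    using self one by (intro orthonormal_eigenbasis_exists) (auto simp: S_def)
  then obtain B where B: "finite B" "pairwise orthogonal B"
      and Bev: "\<forall>b\<in>B. norm b = 1 \<and> (\<exists>c. W *v b = c *\<^sub>R b)" and spanB: "span B = S"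
    by (elim exE conjE)
  have B1: "b \<bullet> 1 = 0" if "b \<in> B" for b
    using that spanB span_base[of b B] by (auto simp: S_def)
  have parseval: "(norm (consensus_proj ** Y))\<^sup>2 = (\<Sum>b\<in>B. (norm (b v* Y))\<^sup>2)" for Y :: "real^'d^'m"
  proof -
    define D where "D = consensus_proj ** Y"
    have "row_mean D = 0"
      by (simp add: D_def consensus_proj_mult row_mean_eq stack_def sum_subtractf scaleR_diff_right
          sum_constant_scaleR del: sum_constant)
    then have "(\<Sum>i\<in>UNIV. D $ i) = 0"
      by (simp add: row_mean_eq)
    then have col: "column j D \<in> S" for j
      by (simp add: S_def column_def inner_vec_def vec_eq_iff)
    have DY: "b v* D = b v* Y" if "b \<in> B" for b
      using B1[OF that]
      by (simp add: D_def consensus_proj_mult vector_matrix_mult_diff_rdistrib vector_matrix_stack)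
    have "(norm D)\<^sup>2 = (\<Sum>i\<in>UNIV. \<Sum>j\<in>UNIV. (D $ i $ j)\<^sup>2)"
      unfolding power2_norm_eq_inner inner_vec_def by (simp add: power2_eq_square)
    also have "\<dots> = (\<Sum>j\<in>UNIV. \<Sum>i\<in>UNIV. (D $ i $ j)\<^sup>2)"
      by (rule sum.swap)
    also have "\<dots> = (\<Sum>j\<in>UNIV. (norm (column j D))\<^sup>2)"
      unfolding power2_norm_eq_inner inner_vec_def by (simp add: power2_eq_square column_def)
    also have "\<dots> = (\<Sum>j\<in>UNIV. \<Sum>b\<in>B. (b \<bullet> column j D)\<^sup>2)"
      using B Bev spanB col by (intro sum.cong refl parseval_in_span) auto
    also have "\<dots> = (\<Sum>b\<in>B. \<Sum>j\<in>UNIV. (b \<bullet> column j D)\<^sup>2)"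
      by (rule sum.swap)
    also have "\<dots> = (\<Sum>b\<in>B. (norm (b v* D))\<^sup>2)"
      unfolding power2_norm_eq_inner inner_vec_def
      by (simp add: power2_eq_square column_def vector_matrix_mult_def)
    finally show ?thesis
      using DY by (simp add: D_def)
  qed
  have "(norm (b v* fast_mix W X K))\<^sup>2 \<le> 1 / 8 * (norm (b v* X))\<^sup>2" if b: "b \<in> B" for b
  proof -
    obtain \<nu> where \<nu>: "W *v b = \<nu> *\<^sub>R b"
      using Bev b by blast
    have "b \<noteq> 0"
      using Bev b by auto
    note bd = weight_matrix_second_eigenvalue[OF W this B1[OF b] \<nu>]
    have "(mix_factor (mix_weight W) \<nu> K)\<^sup>2 \<le> 1 / 8"
      unfolding mix_weight_def using bd K by (intro mix_factor_small) auto
    then show ?thesis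
      using eigenvector_mult_fast_mix[OF tr \<nu>, of X K]
      by (simp only: norm_scaleR power_mult_distrib power2_abs mult_right_mono zero_le_power2)
  qed
  then show ?thesis
    unfolding parseval sum_distrib_left by (rule sum_mono)
qed

section \<open>Smooth convex functions and the proximal map\<close>

text \<open>
  The gradient map \<open>D\<close> is a parameter: everything below follows from the two first-order
  inequalities alone.
\<close>

definition smooth_convex_grad :: "real \<Rightarrow> ('a::real_inner \<Rightarrow> real) \<Rightarrow> ('a \<Rightarrow> 'a) \<Rightarrow> bool" where
  "smooth_convex_grad l \<phi> D \<longleftrightarrow>
    (\<forall>u v. \<phi> u + D u \<bullet> (v - u) \<le> \<phi> v \<and> \<phi> v \<le> \<phi> u + D u \<bullet> (v - u) + l / 2 * (norm (v - u))\<^sup>2)"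

text \<open>
  Compare the lower bound from \<open>u\<close> and the upper bound from \<open>v\<close> at the point
  \<open>v - (D v - D u) / l\<close>, one gradient step from \<open>v\<close> for the function \<open>\<phi> - \<langle>D u, .\<rangle>\<close>, whose minimizer is \<open>u\<close>.
\<close>

lemma smooth_convex_grad_cocoercive:
  assumes "smooth_convex_grad l \<phi> D" and "l > 0"
  shows "\<phi> u + D u \<bullet> (v - u) + 1 / (2 * l) * (norm (D v - D u))\<^sup>2 \<le> \<phi> v"
proof -
  define e where "e = D v - D u"
  define w where "w = v - (1 / l) *\<^sub>R e"
  have lower: "\<phi> u + D u \<bullet> (w - u) \<le> \<phi> w"
    and upper: "\<phi> w \<le> \<phi> v + D v \<bullet> (w - v) + l / 2 * (norm (w - v))\<^sup>2"
    using assms(1) by (auto simp: smooth_convex_grad_def)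
  have "w - v = - ((1 / l) *\<^sub>R e)"
    by (simp add: w_def)
  then have "(norm (w - v))\<^sup>2 = (1 / l)\<^sup>2 * (norm e)\<^sup>2"
    by (simp add: power_mult_distrib power_divide)
  then have n: "l / 2 * (norm (w - v))\<^sup>2 = 1 / (2 * l) * (norm e)\<^sup>2"
    using \<open>l > 0\<close> by (simp add: power2_eq_square)
  have du: "D u \<bullet> (w - u) = D u \<bullet> (v - u) - (1 / l) * (D u \<bullet> e)"
    and dv: "D v \<bullet> (w - v) = - (1 / l) * (D v \<bullet> e)"
    by (simp_all add: w_def inner_diff_right)
  have "D v \<bullet> e - D u \<bullet> e = (norm e)\<^sup>2"
    by (simp add: e_def power2_norm_eq_inner inner_diff_left)
  then have "(1 / l) * (D v \<bullet> e) - (1 / l) * (D u \<bullet> e) = 2 * (1 / (2 * l) * (norm e)\<^sup>2)"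
    by (simp add: diff_divide_distrib[symmetric])
  then show ?thesis
    using lower upper n du dv unfolding e_def by linarith
qed

lemma smooth_convex_grad_lipschitz:
  assumes "smooth_convex_grad l \<phi> D" and "l > 0"
  shows "(norm (D v - D u))\<^sup>2 \<le> l\<^sup>2 * (norm (v - u))\<^sup>2"
proof -
  define e where "e = D v - D u"
  have "1 / l * (norm e)\<^sup>2 \<le> D v \<bullet> (v - u) - D u \<bullet> (v - u)"
  proof -
    have "D v \<bullet> (u - v) = - (D v \<bullet> (v - u))"
      by (simp add: inner_diff_right)
    moreover have "1 / l * (norm e)\<^sup>2 = 2 * (1 / (2 * l) * (norm e)\<^sup>2)"
      by simp
    ultimately show ?thesis
      using smooth_convex_grad_cocoercive[OF assms, of u v] smooth_convex_grad_cocoercive[OF assms, of v u]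
      unfolding e_def by (simp only: norm_minus_commute[of "D u"])
  qed
  also have "\<dots> = e \<bullet> (v - u)"
    by (simp add: e_def inner_diff_left)
  also have "\<dots> \<le> norm e * norm (v - u)"
    by (rule norm_cauchy_schwarz)
  finally have "norm e * norm e \<le> norm e * (l * norm (v - u))"
    using \<open>l > 0\<close> by (simp add: power2_eq_square field_simps)
  then have "norm e \<le> l * norm (v - u)"
    using \<open>l > 0\<close> by (cases "norm e = 0") auto
  then have "(norm e)\<^sup>2 \<le> (l * norm (v - u))\<^sup>2"
    by (intro power_mono) auto
  then show ?thesis
    by (simp add: e_def power_mult_distrib)
qed

text \<open>Moving \<open>\<mu>/2 * |u|^2\<close> out of \<open>f\<close> uses up the strong convexity and lowers the smoothness constant by \<open>\<mu>\<close>.\<close>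

lemma shifted_smooth_convex_grad:
  assumes "L_smooth L f" "strongly_convex \<mu> f"
  shows "smooth_convex_grad (L - \<mu>) (\<lambda>u. f u - \<mu> / 2 * (norm u)\<^sup>2) (\<lambda>u. gradient f u - \<mu> *\<^sub>R u)"
proof -
  have id: "\<mu> / 2 * (norm v)\<^sup>2 = \<mu> / 2 * (norm u)\<^sup>2 + \<mu> * (u \<bullet> (v - u)) + \<mu> / 2 * (norm (u - v))\<^sup>2" for u v :: 'a
    unfolding power2_norm_eq_inner
    by (simp add: inner_diff_left inner_diff_right inner_commute algebra_simps)
  have "f u + gradient f u \<bullet> (v - u) + \<mu> / 2 * (norm (u - v))\<^sup>2 \<le> f v"
    "f v \<le> f u + gradient f u \<bullet> (v - u) + L / 2 * (norm (u - v))\<^sup>2" for u v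
    using assms by (auto simp: L_smooth_def strongly_convex_def)
  moreover have "(L - \<mu>) / 2 * N = L / 2 * N - \<mu> / 2 * N" for N
    by (simp add: diff_divide_distrib left_diff_distrib)
  ultimately show ?thesis
    unfolding smooth_convex_grad_def inner_diff_left inner_scaleR_left
    using id by (smt (verit) norm_minus_commute)
qed

lemma smooth_convex_grad_imp_convex:
  assumes "smooth_convex_grad l \<phi> D"
  shows "convex_on UNIV \<phi>"
proof (rule convex_onI)
  fix t :: real and u v :: 'a
  assume t: "0 < t" "t < 1"
  define q where "q = (1 - t) *\<^sub>R u + t *\<^sub>R v"
  have "\<phi> q + D q \<bullet> (u - q) \<le> \<phi> u" "\<phi> q + D q \<bullet> (v - q) \<le> \<phi> v"
    using assms by (auto simp: smooth_convex_grad_def)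
  then have "(1 - t) * (\<phi> q + D q \<bullet> (u - q)) + t * (\<phi> q + D q \<bullet> (v - q)) \<le> (1 - t) * \<phi> u + t * \<phi> v"
    using t by (intro add_mono mult_left_mono) auto
  moreover have "(1 - t) * (D q \<bullet> (u - q)) + t * (D q \<bullet> (v - q)) = 0"
  proof -
    have "(1 - t) *\<^sub>R (u - q) + t *\<^sub>R (v - q) = 0"
      by (simp add: q_def algebra_simps)
    then show ?thesis
      by (metis inner_add_right inner_scaleR_right inner_zero_right)
  qed
  ultimately show "\<phi> ((1 - t) *\<^sub>R u + t *\<^sub>R v) \<le> (1 - t) * \<phi> u + t * \<phi> v"
    unfolding q_def[symmetric] by (simp add: algebra_simps)
qed simp

lemma convex_on_sum_functions:
  assumes "\<And>i. i \<in> I \<Longrightarrow> convex_on S (\<phi> i)" and "convex S"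
  shows "convex_on S (\<lambda>u. \<Sum>i\<in>I. \<phi> i u)"
  using assms
  by (induction I rule: infinite_finite_induct) (auto simp: convex_on_const intro!: convex_on_add)

lemma convex_on_norm_power2: "convex_on UNIV (\<lambda>v::'a::real_inner. (norm v)\<^sup>2)"
proof (rule convex_onI)
  fix t :: real and u v :: 'a
  assume t: "0 < t" "t < 1"
  have "(1 - t) * (norm u)\<^sup>2 + t * (norm v)\<^sup>2 - (norm ((1 - t) *\<^sub>R u + t *\<^sub>R v))\<^sup>2
    = t * (1 - t) * (norm (u - v))\<^sup>2"
    unfolding power2_norm_eq_inner
    by (simp add: inner_add_left inner_add_right inner_diff_left inner_diff_right inner_commute algebra_simps)
  moreover have "0 \<le> t * (1 - t) * (norm (u - v))\<^sup>2"
    using t by simp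
  ultimately show "(norm ((1 - t) *\<^sub>R u + t *\<^sub>R v))\<^sup>2 \<le> (1 - t) * (norm u)\<^sup>2 + t * (norm v)\<^sup>2"
    by linarith
qed simp

text \<open>
  Minimality along the segment from \<open>p\<close> to \<open>w\<close>, divided by the step length \<open>t\<close>, gives the
  first-order optimality condition in the limit \<open>t \<longrightarrow> 0\<close>. This replaces subgradients of \<open>\<phi>\<close>.
\<close>

lemma strongly_convex_minimizer_growth:
  fixes \<phi> :: "'a::real_inner \<Rightarrow> real"
  assumes conv: "convex_on UNIV \<phi>"
    and min: "\<And>u. \<phi> p + c / 2 * (norm (p - a))\<^sup>2 \<le> \<phi> u + c / 2 * (norm (u - a))\<^sup>2"
  shows "\<phi> p + c / 2 * (norm (p - a))\<^sup>2 + c / 2 * (norm (w - p))\<^sup>2 \<le> \<phi> w + c / 2 * (norm (w - a))\<^sup>2"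
proof -
  define ip where "ip = (p - a) \<bullet> (w - p)"
  define N where "N = (norm (w - p))\<^sup>2"
  have expand: "(norm (p + t *\<^sub>R (w - p) - a))\<^sup>2 = (norm (p - a))\<^sup>2 + 2 * t * ip + t\<^sup>2 * N" for t
  proof -
    have "p + t *\<^sub>R (w - p) - a = (p - a) + t *\<^sub>R (w - p)"
      by simp
    then show ?thesis
      unfolding ip_def N_def
      by (simp only: power2_norm_eq_inner inner_add_left inner_add_right inner_scaleR_left
          inner_scaleR_right inner_commute[of "w - p" "p - a"])
        (simp add: power2_eq_square algebra_simps)
  qed
  have var: "0 \<le> \<phi> w - \<phi> p + c * ip + t * (c / 2 * N)" if t: "t \<in> {0<..<1}" for t
  proof -
    have "p + t *\<^sub>R (w - p) = (1 - t) *\<^sub>R p + t *\<^sub>R w"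
      by (simp add: algebra_simps)
    then have "\<phi> (p + t *\<^sub>R (w - p)) \<le> (1 - t) * \<phi> p + t * \<phi> w"
      using convex_onD[OF conv, of t p w] t by simp
    then have "0 \<le> t * (\<phi> w - \<phi> p) + c / 2 * (2 * t * ip + t\<^sup>2 * N)"
      using min[of "p + t *\<^sub>R (w - p)"] unfolding expand by (simp add: algebra_simps)
    also have "\<dots> = t * (\<phi> w - \<phi> p + c * ip + t * (c / 2 * N))"
      by (simp add: power2_eq_square algebra_simps)
    finally show ?thesis
      using t by (simp add: zero_le_mult_iff)
  qed
  have "((\<lambda>t. \<phi> w - \<phi> p + c * ip + t * (c / 2 * N)) \<longlongrightarrow> \<phi> w - \<phi> p + c * ip + 0 * (c / 2 * N)) (at_right 0)"
    by (intro tendsto_intros)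
  moreover have "eventually (\<lambda>t. 0 \<le> \<phi> w - \<phi> p + c * ip + t * (c / 2 * N)) (at_right 0)"
    using var by (rule eventually_at_rightI) auto
  ultimately have "0 \<le> \<phi> w - \<phi> p + c * ip + 0 * (c / 2 * N)"
    by (rule tendsto_lowerbound) simp
  moreover have "(norm (w - a))\<^sup>2 = (norm (p - a))\<^sup>2 + 2 * ip + N"
    using expand[of 1] by simp
  ultimately show ?thesis
    unfolding N_def[symmetric] by (simp add: algebra_simps)
qed

text \<open>
  The proximal map is an \<^const>\<open>arg_min\<close>, which is only meaningful if the minimum is attained. A finite
  convex function decreases at most linearly in the distance from \<open>u\<close>, so the quadratic term confines the search
  to a ball, where continuity and compactness apply.
\<close>

lemma prox_minimizes:
  assumes conv: "convex_on UNIV g" and "\<gamma> \<ge> 0"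
  shows "\<gamma> * g (prox \<gamma> g u) + 1 / 2 * (norm (prox \<gamma> g u - u))\<^sup>2 \<le> \<gamma> * g w + 1 / 2 * (norm (w - u))\<^sup>2"
proof -
  define h where "h v = \<gamma> * g v + 1 / 2 * (norm (v - u))\<^sup>2" for v
  have cont: "continuous_on S g" for S
    using convex_on_continuous[OF open_UNIV conv] continuous_on_subset by blast
  have "\<exists>v\<in>cball u 1. \<forall>v'\<in>cball u 1. g v \<le> g v'"
    using cont by (intro continuous_attains_inf) auto
  then obtain v0 where v0: "\<And>v. v \<in> cball u 1 \<Longrightarrow> g v0 \<le> g v"
    by blast
  define C where "C = g u - g v0"
  have "C \<ge> 0"
    using v0[of u] by (simp add: C_def)
  have growth: "g u - norm (v - u) * C \<le> g v" if "1 \<le> norm (v - u)" for v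
  proof -
    define r where "r = norm (v - u)"
    have r: "1 \<le> r"
      using that by (simp add: r_def)
    have "u + (1 / r) *\<^sub>R (v - u) = (1 - 1 / r) *\<^sub>R u + (1 / r) *\<^sub>R v"
      by (simp add: algebra_simps)
    then have "g (u + (1 / r) *\<^sub>R (v - u)) \<le> (1 - 1 / r) * g u + (1 / r) * g v"
      using convex_onD[OF conv, of "1 / r" u v] r by simp
    moreover have "u + (1 / r) *\<^sub>R (v - u) \<in> cball u 1"
      using r by (simp add: dist_norm r_def)
    ultimately have "g v0 \<le> (1 - 1 / r) * g u + (1 / r) * g v"
      using v0 by fastforce
    then have "r * g v0 \<le> r * ((1 - 1 / r) * g u + (1 / r) * g v)"
      using r by (intro mult_left_mono) auto
    also have "\<dots> = r * g u - g u + g v"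
      using r by (simp add: field_simps)
    finally show ?thesis
      by (simp add: C_def r_def[symmetric] algebra_simps)
  qed
  \<comment> \<open>Beyond this radius the quadratic \<open>r^2 / 2\<close> outweighs the loss \<open>\<gamma> r C\<close>, so \<open>u\<close> itself does better.\<close>
  define R where "R = 1 + 2 * \<gamma> * C"
  have "R \<ge> 1"
    using \<open>C \<ge> 0\<close> \<open>\<gamma> \<ge> 0\<close> by (simp add: R_def)
  have "\<exists>v\<in>cball u R. \<forall>v'\<in>cball u R. h v \<le> h v'"
    using cont \<open>R \<ge> 1\<close> unfolding h_def by (intro continuous_attains_inf continuous_intros) auto
  then obtain p where p: "\<And>v. v \<in> cball u R \<Longrightarrow> h p \<le> h v"
    by blast
  have "h p \<le> h v" for v
  proof (cases "v \<in> cball u R")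
    case False
    define r where "r = norm (v - u)"
    have r: "R \<le> r" "1 \<le> r"
      using False \<open>R \<ge> 1\<close> by (auto simp: r_def dist_norm norm_minus_commute)
    have "h p \<le> \<gamma> * g u"
      using p[of u] \<open>R \<ge> 1\<close> by (simp add: h_def)
    also have "\<dots> \<le> \<gamma> * g u + r * (r / 2 - \<gamma> * C)"
      using r by (simp add: R_def)
    also have "\<dots> = \<gamma> * (g u - r * C) + 1 / 2 * r\<^sup>2"
      by (simp add: power2_eq_square algebra_simps)
    also have "\<dots> \<le> h v"
      unfolding h_def r_def using growth[of v] r \<open>\<gamma> \<ge> 0\<close>
      by (intro add_right_mono mult_left_mono) (auto simp: r_def)
    finally show ?thesis .
  qed (use p in simp)
  then have "is_arg_min h (\<lambda>_. True) p"
    by (simp add: is_arg_min_linorder)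
  then have "is_arg_min h (\<lambda>_. True) (arg_min h (\<lambda>_. True))"
    unfolding arg_min_def by (rule someI)
  moreover have "arg_min h (\<lambda>_. True) = prox \<gamma> g u"
    by (simp add: prox_def h_def[abs_def])
  ultimately have "h (prox \<gamma> g u) \<le> h w"
    by (simp add: is_arg_min_linorder)
  then show ?thesis
    by (simp add: h_def)
qed

text \<open>
  Scaled by \<open>1 + \<mu> \<gamma>\<close>, the proximal objective is, up to a constant, the linearised objective
  \<open>\<gamma> (\<langle>s, .\<rangle> + h) + |. - z|^2 / 2\<close>: the scaling in the algorithm is what moves
  \<open>\<mu>/2 * |.|^2\<close> into \<open>h\<close>. The inequality is its quadratic growth around the minimizer.
\<close>

lemma prox_step_inequality:
  fixes g :: "real^'d \<Rightarrow> real" and p z s w :: "real^'d"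
  assumes conv: "convex_on UNIV g" and pos: "\<gamma> > 0" "\<mu> > 0"
    and p: "p = prox (\<gamma> / (1 + \<mu> * \<gamma>)) g ((1 / (1 + \<mu> * \<gamma>)) *\<^sub>R (z - \<gamma> *\<^sub>R s))"
  defines "h \<equiv> \<lambda>v. g v + \<mu> / 2 * (norm v)\<^sup>2"
  shows "\<gamma> * (s \<bullet> (p - w)) + \<gamma> * (h p - h w) + 1 / 2 * (norm (p - z))\<^sup>2
      + (1 + \<mu> * \<gamma>) / 2 * (norm (p - w))\<^sup>2 \<le> 1 / 2 * (norm (z - w))\<^sup>2"
proof -
  define k where "k = 1 + \<mu> * \<gamma>"
  have k: "k > 0"
    using pos by (simp add: k_def add_pos_pos)
  define q where "q = z - \<gamma> *\<^sub>R s"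
  define u where "u = (1 / k) *\<^sub>R q"
  have pu: "p = prox (\<gamma> / k) g u"
    by (simp add: p k_def u_def q_def)
  have "(\<gamma> / k) * g p + 1 / 2 * (norm (p - u))\<^sup>2 + 1 / 2 * (norm (w - p))\<^sup>2
      \<le> (\<gamma> / k) * g w + 1 / 2 * (norm (w - u))\<^sup>2"
  proof -
    have "convex_on UNIV (\<lambda>v. (\<gamma> / k) * g v)"
      using pos k conv by (intro convex_on_cmul) auto
    moreover have "(\<gamma> / k) * g p + 1 / 2 * (norm (p - u))\<^sup>2 \<le> (\<gamma> / k) * g v + 1 / 2 * (norm (v - u))\<^sup>2" for v
      unfolding pu using pos k by (intro prox_minimizes conv) auto
    ultimately show ?thesis
      by (rule strongly_convex_minimizer_growth)
  qed
  then have "k * ((\<gamma> / k) * g p + 1 / 2 * (norm (p - u))\<^sup>2 + 1 / 2 * (norm (w - p))\<^sup>2)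
      \<le> k * ((\<gamma> / k) * g w + 1 / 2 * (norm (w - u))\<^sup>2)"
    using k by (intro mult_left_mono) auto
  then have main: "\<gamma> * g p + 1 / 2 * (k * (norm (p - u))\<^sup>2) + k / 2 * (norm (p - w))\<^sup>2
      \<le> \<gamma> * g w + 1 / 2 * (k * (norm (w - u))\<^sup>2)"
    using k by (simp add: distrib_left norm_minus_commute[of w p])
  have sq: "k * (norm (v - u))\<^sup>2 = k * (norm v)\<^sup>2 - 2 * (v \<bullet> q) + k * (norm u)\<^sup>2" for v
  proof -
    have "(norm (v - u))\<^sup>2 = (norm v)\<^sup>2 - 2 * (v \<bullet> u) + (norm u)\<^sup>2"
      by (simp add: power2_norm_eq_inner inner_diff_left inner_diff_right inner_commute)
    moreover have "k * (v \<bullet> u) = v \<bullet> q"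
      using k by (simp add: u_def)
    ultimately show ?thesis
      by (simp only: distrib_left right_diff_distrib mult.left_commute[of k 2])
  qed
  have sq': "(norm (v - z))\<^sup>2 = (norm v)\<^sup>2 - 2 * (v \<bullet> z) + (norm z)\<^sup>2" for v
    by (simp add: power2_norm_eq_inner inner_diff_left inner_diff_right inner_commute)
  have q: "v \<bullet> q = v \<bullet> z - \<gamma> * (s \<bullet> v)" for v
    by (simp add: q_def inner_diff_right inner_commute)
  show ?thesis
    using main unfolding sq q sq' norm_minus_commute[of z w] h_def
    unfolding k_def by (simp add: inner_diff_right algebra_simps)
qed

section \<open>Decomposition into mean and deviation\<close>

lemma row_mean_add: "row_mean (X + Y) = row_mean X + row_mean Y"
  and row_mean_diff: "row_mean (X - Y) = row_mean X - row_mean Y"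
  and row_mean_scaleR: "row_mean (c *\<^sub>R X) = c *\<^sub>R row_mean X"
  for X Y :: "real^'d^'m"
  by (simp_all add: row_mean_eq sum.distrib sum_subtractf scaleR_sum_right[symmetric]
      scaleR_add_right scaleR_diff_right)

lemma row_mean_stack: "row_mean (stack u :: real^'d^'m) = u"
  by (simp add: row_mean_eq stack_def sum_constant_scaleR del: sum_constant)

lemma consensus_proj_add: "consensus_proj ** (X + Y) = consensus_proj ** X + consensus_proj ** Y"
  and consensus_proj_diff: "consensus_proj ** (X - Y) = consensus_proj ** X - consensus_proj ** Y"
  and consensus_proj_scaleR: "consensus_proj ** (c *\<^sub>R X) = c *\<^sub>R (consensus_proj ** X)"
  for X Y :: "real^'d^'m"
  by (simp_all add: consensus_proj_mult row_mean_add row_mean_diff row_mean_scaleR)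
    (simp_all add: stack_def vec_eq_iff algebra_simps)

lemma consensus_proj_stack: "consensus_proj ** (stack u :: real^'d^'m) = 0"
  by (simp add: consensus_proj_mult row_mean_stack)

lemma sum_rows: "(\<Sum>i\<in>UNIV. X $ i) = real CARD('m) *\<^sub>R row_mean X"
  for X :: "real^'d^'m"
  by (simp add: row_mean_eq)

lemma inner_stack: "X \<bullet> stack u = real CARD('m) * (row_mean X \<bullet> u)"
  for X :: "real^'d^'m"
proof -
  have "X \<bullet> stack u = (\<Sum>i\<in>UNIV. X $ i) \<bullet> u"
    unfolding inner_vec_def[of X] by (simp add: stack_def inner_sum_left)
  then show ?thesis
    by (simp add: sum_rows)
qed

lemma inner_mean_deviation:
  "X \<bullet> Y = real CARD('m) * (row_mean X \<bullet> row_mean Y) + (consensus_proj ** X) \<bullet> (consensus_proj ** Y)"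
  for X Y :: "real^'d^'m"
proof -
  have "stack (row_mean X) \<bullet> Y = real CARD('m) * (row_mean X \<bullet> row_mean Y)"
    by (subst inner_commute) (simp add: inner_stack inner_commute)
  then show ?thesis
    by (simp add: consensus_proj_mult inner_diff_left inner_diff_right inner_stack row_mean_stack
        row_mean_diff)
qed

lemma norm_mean_deviation:
  "(norm (X - stack w))\<^sup>2 = real CARD('m) * (norm (row_mean X - w))\<^sup>2 + (norm (consensus_proj ** X))\<^sup>2"
  for X :: "real^'d^'m"
  unfolding power2_norm_eq_inner
  by (subst inner_mean_deviation)
    (simp add: row_mean_diff row_mean_stack consensus_proj_diff consensus_proj_stack)

lemma norm_consensus_proj_le: "norm (consensus_proj ** X) \<le> norm X"
  for X :: "real^'d^'m"
proof -
  have "(norm X)\<^sup>2 = real CARD('m) * (norm (row_mean X))\<^sup>2 + (norm (consensus_proj ** X))\<^sup>2"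
    unfolding power2_norm_eq_inner by (rule inner_mean_deviation)
  then have "(norm (consensus_proj ** X))\<^sup>2 \<le> (norm X)\<^sup>2"
    by simp
  then show ?thesis
    by (rule power2_le_imp_le) simp
qed

lemma norm_power2_rows: "(norm X)\<^sup>2 = (\<Sum>i\<in>UNIV. (norm (X $ i))\<^sup>2)"
  for X :: "real^'d^'m"
  unfolding power2_norm_eq_inner inner_vec_def[of X] ..

lemma convex_row_mean:
  fixes h :: "real^'d \<Rightarrow> real" and X :: "real^'d^'m"
  assumes "convex_on UNIV h"
  shows "real CARD('m) * h (row_mean X) \<le> (\<Sum>i\<in>UNIV. h (X $ i))"
proof -
  have "h (\<Sum>i\<in>UNIV. (1 / real CARD('m)) *\<^sub>R (X $ i)) \<le> (\<Sum>i\<in>UNIV. (1 / real CARD('m)) * h (X $ i))"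
    using assms by (intro convex_on_sum) auto
  then have "h (row_mean X) \<le> (1 / real CARD('m)) * (\<Sum>i\<in>UNIV. h (X $ i))"
    by (simp add: row_mean_eq scaleR_sum_right sum_distrib_left)
  then show ?thesis
    by (simp add: field_simps)
qed

lemma norm_add_power2_le: "(norm (u + v))\<^sup>2 \<le> 2 * ((norm u)\<^sup>2 + (norm v)\<^sup>2)"
  for u v :: "'a::real_inner"
proof -
  have "(norm (u + v))\<^sup>2 + (norm (u - v))\<^sup>2 = 2 * ((norm u)\<^sup>2 + (norm v)\<^sup>2)"
    by (simp add: power2_norm_eq_inner inner_add_left inner_add_right inner_diff_left inner_diff_right)
  then show ?thesis
    by (smt (verit) zero_le_power2)
qed

lemma norm_add3_power2_le: "(norm (u + v + w))\<^sup>2 \<le> 3 * ((norm u)\<^sup>2 + (norm v)\<^sup>2 + (norm w)\<^sup>2)"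
  for u v w :: "'a::real_normed_vector"
proof -
  have "norm (u + v + w) \<le> norm u + norm v + norm w"
    by (rule norm_triangle_le) (simp add: norm_triangle_ineq)
  then have "(norm (u + v + w))\<^sup>2 \<le> (norm u + norm v + norm w)\<^sup>2"
    by (intro power_mono) auto
  also have "\<dots> \<le> 3 * ((norm u)\<^sup>2 + (norm v)\<^sup>2 + (norm w)\<^sup>2)"
  proof -
    have "0 \<le> (norm u - norm v)\<^sup>2 + (norm v - norm w)\<^sup>2 + (norm u - norm w)\<^sup>2"
      by simp
    then show ?thesis
      by (simp add: power2_eq_square algebra_simps)
  qed
  finally show ?thesis .
qed

section \<open>One accelerated proximal step with inexact mean gradient\<close>

text \<open>
  One step of the accelerated proximal gradient method for the row means. The local linearisations
  at the rows of \<open>X\<close> add up to an affine function \<open>lin\<close> with gradient \<open>m * mean S\<close>, which is a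
  lower model at \<open>mean Y\<close> and at \<open>w\<close> and, up to \<open>l/2\<close> times squared distances, an upper model
  at \<open>y'\<close>. As \<open>lin\<close> is affine it splits along \<open>y' = \<tau> mean P + (1 - \<tau>) mean Y\<close>, and the part
  at \<open>mean P\<close> cancels against the summed proximal inequalities. Three terms are kept for the consensus
  errors: the cocoercivity gain at \<open>mean Y\<close>, the movement of the mean of \<open>Z\<close>, and the deviation
  of \<open>P\<close>, hidden in \<open>|P - 1 w|^2\<close>.
\<close>

lemma accelerated_prox_step:
  fixes \<phi> :: "'m::finite \<Rightarrow> real^'d \<Rightarrow> real" and D :: "'m \<Rightarrow> real^'d \<Rightarrow> real^'d"
    and h :: "real^'d \<Rightarrow> real" and X Y Z S P :: "real^'d^'m" and w :: "real^'d"
  assumes smooth: "\<And>i. smooth_convex_grad l (\<phi> i) (D i)" and "l > 0"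
    and conv: "convex_on UNIV h" and \<tau>: "0 < \<tau>" "\<tau> \<le> 1" and "\<gamma> > 0"
    and X: "X = \<tau> *\<^sub>R Z + (1 - \<tau>) *\<^sub>R Y"
    and S: "row_mean S = row_mean (\<chi> i. D i (X $ i))"
    and prox: "\<And>i. \<gamma> * (S $ i \<bullet> (P $ i - w)) + \<gamma> * (h (P $ i) - h w) + 1 / 2 * (norm (P $ i - Z $ i))\<^sup>2
      + (1 + \<tau>) / 2 * (norm (P $ i - w))\<^sup>2 \<le> 1 / 2 * (norm (Z $ i - w))\<^sup>2"
  defines "F \<equiv> \<lambda>u. (\<Sum>i\<in>UNIV. \<phi> i u) + real CARD('m) * h u"
    and "y' \<equiv> \<tau> *\<^sub>R row_mean P + (1 - \<tau>) *\<^sub>R row_mean Y"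
  shows "2 * \<gamma> * (F y' - F w) + \<tau> * ((1 + \<tau>) * (norm (P - stack w))\<^sup>2)
      + (1 - \<tau>) * (\<gamma> / l) * (norm ((\<chi> i. D i (X $ i)) - (\<chi> i. D i (row_mean Y))))\<^sup>2
      + \<tau> * (1 - l * \<gamma> * \<tau>) * (real CARD('m) * (norm (row_mean P - row_mean Z))\<^sup>2)
      + \<tau> * (2 * \<gamma> * ((consensus_proj ** S) \<bullet> (consensus_proj ** P)))
    \<le> (1 - \<tau>) * (2 * \<gamma> * (F (row_mean Y) - F w)) + \<tau> * (norm (Z - stack w))\<^sup>2
      + l * \<gamma> * (norm (consensus_proj ** X))\<^sup>2"
proof -
  define m where "m = real CARD('m)"
  have m: "m > 0"
    by (simp add: m_def)
  define G :: "real^'d^'m" where "G = (\<chi> i. D i (X $ i))"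
  define lin where "lin u = (\<Sum>i\<in>UNIV. \<phi> i (X $ i) + D i (X $ i) \<bullet> (u - X $ i))" for u
  define N where "N = (norm (G - (\<chi> i. D i (row_mean Y))))\<^sup>2"
  define M where "M = m * (norm (row_mean P - row_mean Z))\<^sup>2"
  define V where "V = (norm (consensus_proj ** X))\<^sup>2"
  define c where "c = (consensus_proj ** S) \<bullet> (consensus_proj ** P)"
  define sp where "sp = m * (row_mean S \<bullet> (row_mean P - w))"
  have lin_eq: "lin u = lin w + m * (row_mean S \<bullet> (u - w))" for u
  proof -
    have "lin u - lin w = (\<Sum>i\<in>UNIV. D i (X $ i) \<bullet> (u - w))"
      unfolding lin_def sum_subtractf[symmetric] by (intro sum.cong refl) (simp add: inner_diff_right)
    also have "\<dots> = (\<Sum>i\<in>UNIV. G $ i) \<bullet> (u - w)"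
      by (simp add: inner_sum_left G_def)
    also have "\<dots> = m * (row_mean S \<bullet> (u - w))"
      unfolding sum_rows S G_def[symmetric] m_def by simp
    finally show ?thesis by simp
  qed
  have lin_y': "lin y' = (1 - \<tau>) * lin (row_mean Y) + \<tau> * (lin w + sp)"
  proof -
    have "y' - w = (1 - \<tau>) *\<^sub>R (row_mean Y - w) + \<tau> *\<^sub>R (row_mean P - w)"
      by (simp add: y'_def algebra_simps)
    then have "row_mean S \<bullet> (y' - w)
        = (1 - \<tau>) * (row_mean S \<bullet> (row_mean Y - w)) + \<tau> * (row_mean S \<bullet> (row_mean P - w))"
      by (simp add: inner_add_right)
    then show ?thesis
      unfolding lin_eq[of y'] lin_eq[of "row_mean Y"] sp_def
      by (simp only:) (simp only: algebra_simps)
  qed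
  have upper: "(\<Sum>i\<in>UNIV. \<phi> i y') \<le> lin y' + l / 2 * (\<tau>\<^sup>2 * M + V)"
  proof -
    have "(\<Sum>i\<in>UNIV. \<phi> i y') \<le> (\<Sum>i\<in>UNIV. \<phi> i (X $ i) + D i (X $ i) \<bullet> (y' - X $ i) + l / 2 * (norm (y' - X $ i))\<^sup>2)"
      using smooth by (intro sum_mono) (simp add: smooth_convex_grad_def)
    also have "\<dots> = lin y' + l / 2 * (\<Sum>i\<in>UNIV. (norm (y' - X $ i))\<^sup>2)"
      unfolding lin_def by (simp only: sum.distrib sum_distrib_left)
    also have "(\<Sum>i\<in>UNIV. (norm (y' - X $ i))\<^sup>2) = (norm (X - stack y'))\<^sup>2"
      unfolding norm_power2_rows by (simp add: stack_def norm_minus_commute)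
    also have "\<dots> = m * (norm (row_mean X - y'))\<^sup>2 + V"
      by (simp add: norm_mean_deviation m_def V_def)
    also have "row_mean X - y' = \<tau> *\<^sub>R (row_mean Z - row_mean P)"
      unfolding X row_mean_add row_mean_scaleR y'_def by (simp add: algebra_simps)
    also have "m * (norm \<dots>)\<^sup>2 = \<tau>\<^sup>2 * M"
      by (simp add: M_def power_mult_distrib norm_minus_commute)
    finally show ?thesis .
  qed
  have lower_y: "lin (row_mean Y) + 1 / (2 * l) * N \<le> (\<Sum>i\<in>UNIV. \<phi> i (row_mean Y))"
  proof -
    have "lin (row_mean Y) + 1 / (2 * l) * N
      = (\<Sum>i\<in>UNIV. \<phi> i (X $ i) + D i (X $ i) \<bullet> (row_mean Y - X $ i)
          + 1 / (2 * l) * (norm (D i (row_mean Y) - D i (X $ i)))\<^sup>2)"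
      unfolding lin_def N_def norm_power2_rows sum.distrib sum_distrib_left
      by (simp add: G_def norm_minus_commute)
    also have "\<dots> \<le> (\<Sum>i\<in>UNIV. \<phi> i (row_mean Y))"
      using smooth \<open>l > 0\<close> by (intro sum_mono smooth_convex_grad_cocoercive)
    finally show ?thesis .
  qed
  have lower_w: "lin w \<le> (\<Sum>i\<in>UNIV. \<phi> i w)"
    unfolding lin_def using smooth by (intro sum_mono) (simp add: smooth_convex_grad_def)
  have h_y': "m * h y' \<le> (1 - \<tau>) * (m * h (row_mean Y)) + \<tau> * (m * h (row_mean P))"
  proof -
    have "h y' \<le> (1 - \<tau>) * h (row_mean Y) + \<tau> * h (row_mean P)"
      using convex_onD[OF conv, of \<tau> "row_mean Y" "row_mean P"] \<tau> by (simp add: y'_def add.commute)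
    then have "m * h y' \<le> m * ((1 - \<tau>) * h (row_mean Y) + \<tau> * h (row_mean P))"
      using m by (intro mult_left_mono) auto
    then show ?thesis
      by (simp add: algebra_simps)
  qed
  define HP where "HP = (\<Sum>i\<in>UNIV. h (P $ i))"
  have h_P: "m * h (row_mean P) \<le> HP"
    unfolding m_def HP_def by (rule convex_row_mean[OF conv])
  have prox_sum: "\<gamma> * (sp + c) + \<gamma> * (HP - m * h w) + 1 / 2 * M + (1 + \<tau>) / 2 * (norm (P - stack w))\<^sup>2
      \<le> 1 / 2 * (norm (Z - stack w))\<^sup>2"
  proof -
    have "(\<Sum>i\<in>UNIV. \<gamma> * (S $ i \<bullet> (P $ i - w)) + \<gamma> * (h (P $ i) - h w) + 1 / 2 * (norm (P $ i - Z $ i))\<^sup>2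
      + (1 + \<tau>) / 2 * (norm (P $ i - w))\<^sup>2) \<le> (\<Sum>i\<in>UNIV. 1 / 2 * (norm (Z $ i - w))\<^sup>2)"
      by (intro sum_mono prox)
    moreover have "(\<Sum>i\<in>UNIV. 1 / 2 * (norm (Z $ i - w))\<^sup>2) = 1 / 2 * (norm (Z - stack w))\<^sup>2"
      unfolding norm_power2_rows sum_distrib_left by (simp add: stack_def)
    moreover have "(\<Sum>i\<in>UNIV. \<gamma> * (S $ i \<bullet> (P $ i - w)) + \<gamma> * (h (P $ i) - h w) + 1 / 2 * (norm (P $ i - Z $ i))\<^sup>2
      + (1 + \<tau>) / 2 * (norm (P $ i - w))\<^sup>2)
      = \<gamma> * (S \<bullet> (P - stack w)) + \<gamma> * (HP - m * h w) + 1 / 2 * (norm (P - Z))\<^sup>2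
        + (1 + \<tau>) / 2 * (norm (P - stack w))\<^sup>2"
      unfolding norm_power2_rows inner_vec_def[of S] HP_def m_def
      by (simp add: sum.distrib sum_distrib_left sum_subtractf stack_def right_diff_distrib)
    moreover have "S \<bullet> (P - stack w) = sp + c"
      unfolding inner_mean_deviation[of S] sp_def c_def m_def
      by (simp add: row_mean_diff row_mean_stack consensus_proj_diff consensus_proj_stack)
    moreover have "M \<le> (norm (P - Z))\<^sup>2"
      using norm_mean_deviation[of "P - Z" 0]
      by (simp add: M_def m_def row_mean_diff stack_def zero_vec_def[symmetric])
    ultimately show ?thesis
      by simp
  qed
  have F_le: "F y' \<le> (1 - \<tau>) * (F (row_mean Y) - 1 / (2 * l) * N)
      + \<tau> * (F w + (sp + (HP - m * h w))) + l / 2 * (\<tau>\<^sup>2 * M + V)"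
  proof -
    have "F y' \<le> (1 - \<tau>) * (lin (row_mean Y) + m * h (row_mean Y))
        + \<tau> * (lin w + sp + m * h (row_mean P)) + l / 2 * (\<tau>\<^sup>2 * M + V)"
      using upper h_y' unfolding F_def m_def[symmetric] lin_y' by (simp add: algebra_simps)
    also have "\<dots> \<le> (1 - \<tau>) * (F (row_mean Y) - 1 / (2 * l) * N)
        + \<tau> * (F w + (sp + (HP - m * h w))) + l / 2 * (\<tau>\<^sup>2 * M + V)"
    proof -
      have "lin (row_mean Y) + m * h (row_mean Y) \<le> F (row_mean Y) - 1 / (2 * l) * N"
        using lower_y by (simp add: F_def m_def)
      then have "(1 - \<tau>) * (lin (row_mean Y) + m * h (row_mean Y)) \<le> (1 - \<tau>) * (F (row_mean Y) - 1 / (2 * l) * N)"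
        using \<tau> by (intro mult_left_mono) auto
      moreover have "lin w + sp + m * h (row_mean P) \<le> F w + (sp + (HP - m * h w))"
        using lower_w h_P by (simp add: F_def m_def)
      then have "\<tau> * (lin w + sp + m * h (row_mean P)) \<le> \<tau> * (F w + (sp + (HP - m * h w)))"
        using \<tau> by (intro mult_left_mono) auto
      ultimately show ?thesis
        by linarith
    qed
    finally show ?thesis .
  qed
  define N1 where "N1 = 2 * \<gamma> * (1 / (2 * l) * N)"
  have N1: "N1 = \<gamma> / l * N"
    by (simp add: N1_def)
  define F1 where "F1 = F (row_mean Y) - F w"
  define e where "e = sp + (HP - m * h w)"
  have "2 * \<gamma> * F y' \<le> 2 * \<gamma> * ((1 - \<tau>) * (F (row_mean Y) - 1 / (2 * l) * N)
      + \<tau> * (F w + (sp + (HP - m * h w))) + l / 2 * (\<tau>\<^sup>2 * M + V))"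
    using F_le \<open>\<gamma> > 0\<close> by (intro mult_left_mono) auto
  also have "\<dots> = (1 - \<tau>) * (2 * \<gamma> * F (row_mean Y) - N1) + \<tau> * (2 * \<gamma> * F w) + \<tau> * (2 * \<gamma> * e)
      + l * \<gamma> * (\<tau>\<^sup>2 * M + V)"
    unfolding N1_def e_def by algebra
  finally have step: "2 * \<gamma> * (F y' - F w) \<le> (1 - \<tau>) * (2 * \<gamma> * F1) - (1 - \<tau>) * N1
      + \<tau> * (2 * \<gamma> * e) + l * \<gamma> * (\<tau>\<^sup>2 * M + V)"
    unfolding F1_def by (simp add: algebra_simps)
  have "\<tau> * (2 * \<gamma> * e + 2 * \<gamma> * c + M + (1 + \<tau>) * (norm (P - stack w))\<^sup>2) \<le> \<tau> * (norm (Z - stack w))\<^sup>2"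
    using prox_sum \<tau> unfolding e_def by (intro mult_left_mono) (auto simp: field_simps)
  with step show ?thesis
    unfolding G_def[symmetric] N_def[symmetric] M_def[symmetric, unfolded m_def] V_def[symmetric]
      c_def[symmetric] F1_def[symmetric] mult.assoc[of "1 - \<tau>" "\<gamma> / l" N] N1[symmetric]
    by (simp add: algebra_simps power2_eq_square M_def m_def)
qed

section \<open>Decay of the Lyapunov function\<close>

text \<open>
  The numerical core. Here \<open>A\<close> stands for the scaled objective gap, \<open>B\<close> for the
  distance of the mean of \<open>z\<close> to the optimum, \<open>Z, U, R, Q\<close> the scaled deviations of \<open>z, y, s, x\<close>, \<open>M\<close> the
  last movement of the mean of \<open>z\<close>, \<open>G\<close> the gradient change and \<open>P\<close> the deviation of the
  proximal output; a prime marks the next iterate. The weights \<open>2, 1, 2, 1/2, 1/400\<close> of the error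
  terms leave slack throughout: what they contribute to the next step is less than \<open>39/40\<close> of
  their present weight, and \<open>39/40 \<le> 1 - \<tau>/2\<close>, so the rate is decided by \<open>A\<close> and \<open>B\<close>. The first bound keeps the sharper coefficients that are
  needed for the first step.
\<close>

lemma lyapunov_contraction:
  fixes \<tau> :: real
  assumes \<tau>: "0 < \<tau>" "\<tau> \<le> 1 / 20"
    and nonneg: "0 \<le> A" "0 \<le> B" "0 \<le> Z" "0 \<le> U" "0 \<le> R" "0 \<le> M" "0 \<le> Q"
      "0 \<le> M'" "0 \<le> G" "0 \<le> P"
    and main: "A' + (1 + \<tau>) * (B' + P) + 399 / 400 * M' + 380 * G + c \<le> (1 - \<tau>) * A + (B + Z) + Q' / 400"
    and cross: "- c \<le> 2 * R' + P / 2"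
    and Z': "Z' \<le> 1 / 8 * P" and Q': "Q' \<le> 2 * (Z + U)" and U': "U' \<le> 1 / 8 * (2 * (Z' + U))"
    and R': "R' \<le> 1 / 8 * (3 * (R + G + (M + Q) / 160000))"
  shows "A' + (1 + \<tau>) * B' + 2 * Z' + U' + 2 * R' + M' / 2 + Q' / 400
      \<le> (1 - \<tau>) * A + B + 101 / 100 * Z + 13 / 50 * U + 3 / 2 * R + (M + Q) / 100000"
    and "A' + (1 + \<tau>) * B' + 2 * Z' + U' + 2 * R' + M' / 2 + Q' / 400
      \<le> (1 - \<tau> / 2) * (A + (1 + \<tau>) * B + 2 * Z + U + 2 * R + M / 2 + Q / 400)"
proof -
  have "0 \<le> \<tau> * P"
    using \<tau> nonneg by simp
  show first: "A' + (1 + \<tau>) * B' + 2 * Z' + U' + 2 * R' + M' / 2 + Q' / 400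
      \<le> (1 - \<tau>) * A + B + 101 / 100 * Z + 13 / 50 * U + 3 / 2 * R + (M + Q) / 100000"
  proof -
    have "A' + (1 + \<tau>) * B' + P + \<tau> * P + 399 / 400 * M' + 380 * G + c \<le> (1 - \<tau>) * A + (B + Z) + Q' / 400"
      using main by (simp add: distrib_left distrib_right)
    then show ?thesis
      using \<open>0 \<le> \<tau> * P\<close> cross Z' Q' U' R' nonneg by argo
  qed
  have B: "B \<le> (1 - \<tau> / 2) * (1 + \<tau>) * B"
  proof -
    have "\<tau> * \<tau> \<le> \<tau> * 1"
      using \<tau> by (intro mult_left_mono) auto
    then have "1 \<le> (1 - \<tau> / 2) * (1 + \<tau>)"
      by (simp add: algebra_simps)
    then show ?thesis
      using nonneg mult_right_mono[of 1 "(1 - \<tau> / 2) * (1 + \<tau>)" B] by simp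
  qed
  have A: "(1 - \<tau>) * A \<le> (1 - \<tau> / 2) * A"
    using \<tau> nonneg by (intro mult_right_mono) auto
  have "39 / 40 * (2 * Z + U + 2 * R + M / 2 + Q / 400) \<le> (1 - \<tau> / 2) * (2 * Z + U + 2 * R + M / 2 + Q / 400)"
    using \<tau> nonneg by (intro mult_right_mono) auto
  moreover have "(1 - \<tau> / 2) * (A + (1 + \<tau>) * B + 2 * Z + U + 2 * R + M / 2 + Q / 400)
    = (1 - \<tau> / 2) * A + (1 - \<tau> / 2) * (1 + \<tau>) * B + (1 - \<tau> / 2) * (2 * Z + U + 2 * R + M / 2 + Q / 400)"
    by (simp add: field_simps)
  ultimately show "A' + (1 + \<tau>) * B' + 2 * Z' + U' + 2 * R' + M' / 2 + Q' / 400
      \<le> (1 - \<tau> / 2) * (A + (1 + \<tau>) * B + 2 * Z + U + 2 * R + M / 2 + Q / 400)"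
    using first A B nonneg by argo
qed

section \<open>Runs with gradient tracking and consensus contraction\<close>

text \<open>
  The algorithm reduced to what the analysis uses: mixing preserves means and contracts deviations, and the
  proximal output \<open>p t\<close> satisfies its growth inequality against the fixed comparison point \<open>w\<close>,
  around which the total objective \<open>F\<close> grows quadratically. The \<open>\<mu>\<close>-quadratic is part of \<open>h\<close>.
\<close>

locale tracked_accelerated_run =
  fixes mix :: "real^'d^'m::finite \<Rightarrow> real^'d^'m"
    and \<phi> :: "'m \<Rightarrow> real^'d \<Rightarrow> real" and D :: "'m \<Rightarrow> real^'d \<Rightarrow> real^'d" and h :: "real^'d \<Rightarrow> real"
    and \<mu> l \<gamma> \<tau> :: real and x1 w :: "real^'d"
    and x y z s p :: "nat \<Rightarrow> real^'d^'m"
  fixes grads :: "real^'d^'m \<Rightarrow> real^'d^'m" and F :: "real^'d \<Rightarrow> real"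
  defines "grads \<equiv> \<lambda>X. \<chi> i. D i (X $ i)"
    and "F \<equiv> \<lambda>u. (\<Sum>i\<in>UNIV. \<phi> i u) + real CARD('m) * h u"
  assumes mix_mean: "\<And>X. row_mean (mix X) = row_mean X"
    and mix_contraction: "\<And>X. (norm (consensus_proj ** mix X))\<^sup>2 \<le> 1 / 8 * (norm (consensus_proj ** X))\<^sup>2"
    and smooth: "\<And>i. smooth_convex_grad l (\<phi> i) (D i)"
    and conv: "convex_on UNIV h"
    and \<mu>_pos: "0 < \<mu>" and \<mu>_le: "\<mu> \<le> l"
    and \<gamma>_eq: "\<gamma> = 1 / (20 * sqrt (l * \<mu>))" and \<tau>_eq: "\<tau> = \<mu> * \<gamma>"
    and x_1: "x 1 = stack x1" and y_1: "y 1 = stack x1" and z_1: "z 1 = stack x1"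
    and s_1: "s 1 = grads (x 1)"
    and x_Suc: "\<And>t. t \<ge> 1 \<Longrightarrow> x (Suc t) = \<tau> *\<^sub>R z t + (1 - \<tau>) *\<^sub>R y t"
    and s_Suc: "\<And>t. t \<ge> 1 \<Longrightarrow> s (Suc t) = mix (s t + grads (x (Suc t)) - grads (x t))"
    and z_Suc: "\<And>t. t \<ge> 1 \<Longrightarrow> z (Suc t) = mix (p t)"
    and y_Suc: "\<And>t. t \<ge> 1 \<Longrightarrow> y (Suc t) = mix (\<tau> *\<^sub>R z (Suc t) + (1 - \<tau>) *\<^sub>R y t)"
    and prox_step: "\<And>t i. t \<ge> 1 \<Longrightarrow>
      \<gamma> * (s (Suc t) $ i \<bullet> (p t $ i - w)) + \<gamma> * (h (p t $ i) - h w) + 1 / 2 * (norm (p t $ i - z t $ i))\<^sup>2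
        + (1 + \<tau>) / 2 * (norm (p t $ i - w))\<^sup>2 \<le> 1 / 2 * (norm (z t $ i - w))\<^sup>2"
    and growth: "\<And>u. F w + real CARD('m) * \<mu> / 2 * (norm (u - w))\<^sup>2 \<le> F u"
begin

definition gap :: "nat \<Rightarrow> real" where
  "gap t = 2 / \<mu> * (F (row_mean (y t)) - F w)"

definition mean_dist :: "nat \<Rightarrow> real" where
  "mean_dist t = real CARD('m) * (norm (row_mean (z t) - w))\<^sup>2"

definition z_dev :: "nat \<Rightarrow> real" where
  "z_dev t = (norm (consensus_proj ** z t))\<^sup>2"

text \<open>
  The deviations of \<open>x\<close> and \<open>y\<close> are of the order of \<open>\<tau>\<close> times that of \<open>z\<close>; dividing by
  \<open>\<tau>^2\<close> makes the coefficients of all recursions independent of the condition number. The factor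
  \<open>\<gamma>^2\<close> has the same purpose for gradients.
\<close>

definition y_dev :: "nat \<Rightarrow> real" where
  "y_dev t = (norm (consensus_proj ** y t))\<^sup>2 / \<tau>\<^sup>2"

definition x_dev :: "nat \<Rightarrow> real" where
  "x_dev t = (norm (consensus_proj ** x t))\<^sup>2 / \<tau>\<^sup>2"

definition s_dev :: "nat \<Rightarrow> real" where
  "s_dev t = \<gamma>\<^sup>2 * (norm (consensus_proj ** s t))\<^sup>2"

text \<open>At the first iterate \<open>x 1 = y 1\<close>, which corresponds to no preceding movement.\<close>

definition movement :: "nat \<Rightarrow> real" where
  "movement t = (if t = 1 then 0 else real CARD('m) * (norm (row_mean (z t) - row_mean (z (t - 1))))\<^sup>2)"

definition grad_change :: "nat \<Rightarrow> real" where
  "grad_change t = \<gamma>\<^sup>2 * (norm (grads (x (Suc t)) - grads (stack (row_mean (y t)))))\<^sup>2"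

definition lyapunov :: "nat \<Rightarrow> real" where
  "lyapunov t = gap t + (1 + \<tau>) * mean_dist t + 2 * z_dev t + y_dev t + 2 * s_dev t
    + movement t / 2 + x_dev t / 400"

lemma step_size_pos: "0 < \<gamma>" "0 < \<tau>" "0 < l"
  using \<mu>_pos \<mu>_le by (auto simp: \<gamma>_eq \<tau>_eq)

lemma step_size_identities:
  shows "l * \<mu> * \<gamma>\<^sup>2 = 1 / 400" "l * \<gamma> * \<tau> = 1 / 400" "\<tau> \<le> 1 / 20"
proof -
  show 1: "l * \<mu> * \<gamma>\<^sup>2 = 1 / 400"
    using \<mu>_pos step_size_pos by (simp add: \<gamma>_eq power_divide power_mult_distrib)
  then show "l * \<gamma> * \<tau> = 1 / 400"
    by (simp add: \<tau>_eq power2_eq_square algebra_simps)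
  have "\<tau>\<^sup>2 = \<mu> * \<mu> * \<gamma>\<^sup>2"
    by (simp add: \<tau>_eq power2_eq_square)
  also have "\<dots> \<le> l * \<mu> * \<gamma>\<^sup>2"
    using \<mu>_pos \<mu>_le by (intro mult_right_mono) auto
  also have "\<dots> = (1 / 20)\<^sup>2"
    unfolding 1 by (simp add: power2_eq_square)
  finally show "\<tau> \<le> 1 / 20"
    by (rule power2_le_imp_le) simp
qed

lemma dev_nonneg:
  "0 \<le> gap t" "0 \<le> mean_dist t" "0 \<le> z_dev t" "0 \<le> y_dev t" "0 \<le> x_dev t" "0 \<le> s_dev t"
  "0 \<le> movement t" "0 \<le> grad_change t"
proof -
  have "0 \<le> real CARD('m) * \<mu> / 2 * (norm (row_mean (y t) - w))\<^sup>2"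
    using \<mu>_pos by simp
  then have "F w \<le> F (row_mean (y t))"
    using growth[of "row_mean (y t)"] by linarith
  then show "0 \<le> gap t"
    using \<mu>_pos by (simp add: gap_def)
qed (auto simp: mean_dist_def z_dev_def y_dev_def x_dev_def s_dev_def movement_def grad_change_def)

lemma mean_tracking: "t \<ge> 1 \<Longrightarrow> row_mean (s t) = row_mean (grads (x t))"
proof (induction t rule: nat_induct_at_least)
  case base
  show ?case by (simp only: s_1)
next
  case (Suc t)
  then show ?case
    by (simp add: s_Suc mix_mean row_mean_add row_mean_diff)
qed

lemma mean_z_Suc: "t \<ge> 1 \<Longrightarrow> row_mean (z (Suc t)) = row_mean (p t)"
  by (simp add: z_Suc mix_mean)

lemma mean_y_Suc: "t \<ge> 1 \<Longrightarrow> row_mean (y (Suc t)) = \<tau> *\<^sub>R row_mean (z (Suc t)) + (1 - \<tau>) *\<^sub>R row_mean (y t)"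
  by (simp add: y_Suc mix_mean row_mean_add row_mean_scaleR)

text \<open>
  The means of \<open>x t\<close> and \<open>y t\<close> are combinations with the same weights of the mean of \<open>y (t-1)\<close>
  with the means of \<open>z (t-1)\<close> and \<open>z t\<close>, respectively.
\<close>

lemma dist_x_mean_y:
  assumes "t \<ge> 1"
  shows "(norm (x t - stack (row_mean (y t))))\<^sup>2 = \<tau>\<^sup>2 * (movement t + x_dev t)"
proof -
  have "real CARD('m) * (norm (row_mean (x t) - row_mean (y t)))\<^sup>2 = \<tau>\<^sup>2 * movement t"
  proof (cases "t = 1")
    case True
    show ?thesis
      unfolding True x_1 y_1 by (simp add: movement_def)
  next
    case False
    then obtain k where k: "t = Suc k" "k \<ge> 1"
      using assms by (cases t) auto
    have "row_mean (x t) - row_mean (y t) = \<tau> *\<^sub>R (row_mean (z k) - row_mean (z t))"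
      unfolding k(1) mean_y_Suc[OF k(2)] x_Suc[OF k(2)] row_mean_add row_mean_scaleR
      by (simp add: algebra_simps)
    then have "(norm (row_mean (x t) - row_mean (y t)))\<^sup>2 = \<tau>\<^sup>2 * (norm (row_mean (z t) - row_mean (z k)))\<^sup>2"
      by (simp add: power_mult_distrib norm_minus_commute)
    then show ?thesis
      using False k by (simp add: movement_def)
  qed
  moreover have "(norm (consensus_proj ** x t))\<^sup>2 = \<tau>\<^sup>2 * x_dev t"
    using step_size_pos by (simp add: x_dev_def)
  ultimately show ?thesis
    unfolding norm_mean_deviation by (simp add: distrib_left)
qed

text \<open>The gradient change is split at the consensual point \<open>mean (y t)\<close>; the Lipschitz part carries
  \<open>(l \<gamma> \<tau>)^2 = 1/160000\<close>.\<close>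

lemma s_dev_Suc:
  assumes t: "t \<ge> 1"
  shows "s_dev (Suc t) \<le> 1 / 8 * (3 * (s_dev t + grad_change t + (movement t + x_dev t) / 160000))"
proof -
  define u where "u = stack (row_mean (y t)) - x t"
  define a where "a = grads (x (Suc t)) - grads (stack (row_mean (y t)))"
  define b where "b = grads (stack (row_mean (y t))) - grads (x t)"
  have b: "\<gamma>\<^sup>2 * (norm b)\<^sup>2 \<le> (movement t + x_dev t) / 160000"
  proof -
    have "(norm b)\<^sup>2 \<le> (\<Sum>i\<in>UNIV. l\<^sup>2 * (norm (u $ i))\<^sup>2)"
      unfolding norm_power2_rows b_def u_def grads_def
      using smooth_convex_grad_lipschitz[OF smooth step_size_pos(3)] by (intro sum_mono) simp
    also have "\<dots> = l\<^sup>2 * (norm (x t - stack (row_mean (y t))))\<^sup>2"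
      unfolding norm_minus_commute[of "x t"] u_def[symmetric] norm_power2_rows sum_distrib_left ..
    also have "\<dots> = l\<^sup>2 * (\<tau>\<^sup>2 * (movement t + x_dev t))"
      by (simp add: dist_x_mean_y[OF t])
    finally have "\<gamma>\<^sup>2 * (norm b)\<^sup>2 \<le> \<gamma>\<^sup>2 * (l\<^sup>2 * (\<tau>\<^sup>2 * (movement t + x_dev t)))"
      by (intro mult_left_mono) auto
    also have "\<dots> = (l * \<gamma> * \<tau>)\<^sup>2 * (movement t + x_dev t)"
      by (simp only: power_mult_distrib ac_simps)
    finally show ?thesis
      unfolding step_size_identities(2) by (simp add: power2_eq_square)
  qed
  have split: "s t + grads (x (Suc t)) - grads (x t) = s t + a + b"
    by (simp add: a_def b_def)
  have "(norm (consensus_proj ** s (Suc t)))\<^sup>2 \<le> 1 / 8 * (norm (consensus_proj ** (s t + a + b)))\<^sup>2"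
    unfolding s_Suc[OF t] split by (rule mix_contraction)
  also have "\<dots> \<le> 1 / 8 * (3 * ((norm (consensus_proj ** s t))\<^sup>2 + (norm (consensus_proj ** a))\<^sup>2
      + (norm (consensus_proj ** b))\<^sup>2))"
    unfolding consensus_proj_add by (intro mult_left_mono norm_add3_power2_le) auto
  also have "\<dots> \<le> 1 / 8 * (3 * ((norm (consensus_proj ** s t))\<^sup>2 + (norm a)\<^sup>2 + (norm b)\<^sup>2))"
    by (intro mult_left_mono add_mono power_mono norm_consensus_proj_le) auto
  finally have "s_dev (Suc t) \<le> \<gamma>\<^sup>2 * (1 / 8 * (3 * ((norm (consensus_proj ** s t))\<^sup>2 + (norm a)\<^sup>2 + (norm b)\<^sup>2)))"
    unfolding s_dev_def by (intro mult_left_mono) auto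
  also have "\<dots> = 1 / 8 * (3 * (s_dev t + grad_change t + \<gamma>\<^sup>2 * (norm b)\<^sup>2))"
    by (simp add: s_dev_def grad_change_def a_def algebra_simps)
  also have "\<dots> \<le> 1 / 8 * (3 * (s_dev t + grad_change t + (movement t + x_dev t) / 160000))"
    using b by simp
  finally show ?thesis .
qed

lemma x_dev_Suc:
  assumes t: "t \<ge> 1"
  shows "x_dev (Suc t) \<le> 2 * (z_dev t + y_dev t)"
proof -
  have "(norm (consensus_proj ** x (Suc t)))\<^sup>2
      \<le> 2 * ((norm (\<tau> *\<^sub>R (consensus_proj ** z t)))\<^sup>2 + (norm ((1 - \<tau>) *\<^sub>R (consensus_proj ** y t)))\<^sup>2)"
    unfolding x_Suc[OF t] consensus_proj_add consensus_proj_scaleR by (rule norm_add_power2_le)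
  also have "\<dots> \<le> 2 * (\<tau>\<^sup>2 * z_dev t + 1 * (norm (consensus_proj ** y t))\<^sup>2)"
    unfolding norm_scaleR power_mult_distrib z_dev_def power2_abs
    using step_size_pos step_size_identities(3)
    by (intro mult_left_mono add_mono mult_right_mono) (auto simp: power_le_one)
  also have "\<dots> = \<tau>\<^sup>2 * (2 * (z_dev t + y_dev t))"
    using step_size_pos by (simp add: y_dev_def algebra_simps)
  finally show ?thesis
    using step_size_pos by (simp add: x_dev_def pos_divide_le_eq mult.commute)
qed

lemma y_dev_Suc:
  assumes t: "t \<ge> 1"
  shows "y_dev (Suc t) \<le> 1 / 8 * (2 * (z_dev (Suc t) + y_dev t))"
proof -
  have "(norm (consensus_proj ** y (Suc t)))\<^sup>2
      \<le> 1 / 8 * (norm (consensus_proj ** (\<tau> *\<^sub>R z (Suc t) + (1 - \<tau>) *\<^sub>R y t)))\<^sup>2"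
    unfolding y_Suc[OF t] by (rule mix_contraction)
  also have "\<dots> \<le> 1 / 8 * (2 * ((norm (\<tau> *\<^sub>R (consensus_proj ** z (Suc t))))\<^sup>2
      + (norm ((1 - \<tau>) *\<^sub>R (consensus_proj ** y t)))\<^sup>2))"
    unfolding consensus_proj_add consensus_proj_scaleR by (intro mult_left_mono norm_add_power2_le) auto
  also have "\<dots> \<le> 1 / 8 * (2 * (\<tau>\<^sup>2 * z_dev (Suc t) + 1 * (norm (consensus_proj ** y t))\<^sup>2))"
    unfolding norm_scaleR power_mult_distrib z_dev_def power2_abs
    using step_size_pos step_size_identities(3)
    by (intro mult_left_mono add_mono mult_right_mono) (auto simp: power_le_one)
  also have "\<dots> = \<tau>\<^sup>2 * (1 / 8 * (2 * (z_dev (Suc t) + y_dev t)))"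
    using step_size_pos by (simp add: y_dev_def algebra_simps)
  finally show ?thesis
    using step_size_pos by (simp add: y_dev_def[of "Suc t"] pos_divide_le_eq mult.commute)
qed

text \<open>
  The step inequality divided by \<open>\<tau>\<close>. The step sizes turn its coefficients into numbers:
  \<open>\<gamma> / (l \<tau>) = 400 \<gamma>^2\<close> and \<open>l \<gamma> / \<tau> = 1 / (400 \<tau>^2)\<close>.
\<close>

lemma descent:
  assumes t: "t \<ge> 1"
  shows "gap (Suc t) + (1 + \<tau>) * (mean_dist (Suc t) + (norm (consensus_proj ** p t))\<^sup>2)
      + 399 / 400 * movement (Suc t) + 380 * grad_change t
      + 2 * \<gamma> * ((consensus_proj ** s (Suc t)) \<bullet> (consensus_proj ** p t))
    \<le> (1 - \<tau>) * gap t + (mean_dist t + z_dev t) + x_dev (Suc t) / 400"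
proof -
  have \<tau>: "0 < \<tau>" "\<tau> \<le> 1 / 20"
    using step_size_pos step_size_identities by auto
  define N where "N = (norm (grads (x (Suc t)) - grads (stack (row_mean (y t)))))\<^sup>2"
  define c where "c = 2 * \<gamma> * ((consensus_proj ** s (Suc t)) \<bullet> (consensus_proj ** p t))"
  define V where "V = (norm (consensus_proj ** x (Suc t)))\<^sup>2"
  have step: "2 * \<gamma> * (F (row_mean (y (Suc t))) - F w) + \<tau> * ((1 + \<tau>) * (norm (p t - stack w))\<^sup>2)
      + (1 - \<tau>) * (\<gamma> / l) * N + \<tau> * (1 - l * \<gamma> * \<tau>) * movement (Suc t) + \<tau> * c
    \<le> (1 - \<tau>) * (2 * \<gamma> * (F (row_mean (y t)) - F w)) + \<tau> * (norm (z t - stack w))\<^sup>2 + l * \<gamma> * V"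
    using accelerated_prox_step[OF smooth step_size_pos(3) conv \<tau>(1) _ step_size_pos(1) x_Suc[OF t]
        mean_tracking[of "Suc t", unfolded grads_def] prox_step[OF t]] \<tau> t
    unfolding F_def N_def c_def V_def mean_y_Suc[OF t] mean_z_Suc[OF t] grads_def
    by (simp add: movement_def stack_def mean_z_Suc[OF t])
  have "2 * \<gamma> = \<tau> * (2 / \<mu>)"
    using \<mu>_pos by (simp add: \<tau>_eq)
  then have gaps: "2 * \<gamma> * (F (row_mean (y k)) - F w) = \<tau> * gap k" for k
    by (simp only: gap_def mult.assoc)
  have "\<gamma> / l = \<tau> * (400 * \<gamma>\<^sup>2)"
  proof -
    have "\<tau> * (400 * \<gamma>\<^sup>2) = 400 * (l * \<mu> * \<gamma>\<^sup>2) * \<gamma> / l"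
      using step_size_pos by (simp add: \<tau>_eq)
    then show ?thesis
      unfolding step_size_identities(1) by simp
  qed
  then have changes: "(1 - \<tau>) * (\<gamma> / l) * N = \<tau> * ((1 - \<tau>) * (400 * grad_change t))"
    by (simp add: grad_change_def N_def)
  have devs: "l * \<gamma> * V = \<tau> * (x_dev (Suc t) / 400)"
  proof -
    have "V = \<tau>\<^sup>2 * x_dev (Suc t)"
      using \<tau> by (simp add: V_def x_dev_def)
    then have "l * \<gamma> * V = \<tau> * ((l * \<gamma> * \<tau>) * x_dev (Suc t))"
      by (simp add: power2_eq_square)
    then show ?thesis
      unfolding step_size_identities(2) by simp
  qed
  have "\<tau> * (gap (Suc t) + (1 + \<tau>) * (norm (p t - stack w))\<^sup>2
      + (1 - \<tau>) * (400 * grad_change t) + 399 / 400 * movement (Suc t) + c)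
    \<le> \<tau> * ((1 - \<tau>) * gap t + (norm (z t - stack w))\<^sup>2 + x_dev (Suc t) / 400)"
    using step unfolding gaps changes devs step_size_identities(2)
    by (simp add: distrib_left mult.left_commute[of "1 - \<tau>" \<tau>] mult.assoc)
  then have "gap (Suc t) + (1 + \<tau>) * (norm (p t - stack w))\<^sup>2
      + (1 - \<tau>) * (400 * grad_change t) + 399 / 400 * movement (Suc t) + c
    \<le> (1 - \<tau>) * gap t + (norm (z t - stack w))\<^sup>2 + x_dev (Suc t) / 400"
    using \<tau>(1) by (simp only: mult_le_cancel_left_pos)
  moreover have "380 * grad_change t \<le> (1 - \<tau>) * (400 * grad_change t)"
    using \<tau> dev_nonneg(8)[of t] mult_right_mono[of "380 / 400" "1 - \<tau>" "400 * grad_change t"] by simp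
  moreover have "(norm (p t - stack w))\<^sup>2 = mean_dist (Suc t) + (norm (consensus_proj ** p t))\<^sup>2"
    by (simp add: norm_mean_deviation mean_dist_def mean_z_Suc[OF t])
  moreover have "(norm (z t - stack w))\<^sup>2 = mean_dist t + z_dev t"
    by (simp add: norm_mean_deviation mean_dist_def z_dev_def)
  ultimately show ?thesis
    unfolding c_def by simp
qed

lemma lyapunov_Suc:
  assumes t: "t \<ge> 1"
  shows "lyapunov (Suc t) \<le> (1 - \<tau>) * gap t + mean_dist t + 101 / 100 * z_dev t + 13 / 50 * y_dev t
      + 3 / 2 * s_dev t + (movement t + x_dev t) / 100000"
    and "lyapunov (Suc t) \<le> (1 - \<tau> / 2) * lyapunov t"
proof -
  define a where "a = \<gamma> *\<^sub>R (consensus_proj ** s (Suc t))"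
  define b where "b = consensus_proj ** p t"
  have "- (2 * (a \<bullet> b)) \<le> 2 * (norm a)\<^sup>2 + (norm b)\<^sup>2 / 2"
  proof -
    have "0 \<le> (norm (2 *\<^sub>R a + b))\<^sup>2"
      by simp
    also have "\<dots> = 2 * (2 * (norm a)\<^sup>2 + (norm b)\<^sup>2 / 2 + 2 * (a \<bullet> b))"
      unfolding power2_norm_eq_inner by (simp add: inner_add_left inner_add_right inner_commute)
    finally show ?thesis by simp
  qed
  then have cross: "- (2 * \<gamma> * ((consensus_proj ** s (Suc t)) \<bullet> b)) \<le> 2 * s_dev (Suc t) + (norm b)\<^sup>2 / 2"
    by (simp add: a_def s_dev_def power_mult_distrib)
  have z: "z_dev (Suc t) \<le> 1 / 8 * (norm b)\<^sup>2"
    unfolding z_dev_def z_Suc[OF t] b_def by (rule mix_contraction)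
  note contr = lyapunov_contraction[OF step_size_pos(2) step_size_identities(3)
      dev_nonneg(1)[of t] dev_nonneg(2)[of t] dev_nonneg(3)[of t] dev_nonneg(4)[of t] dev_nonneg(6)[of t]
      dev_nonneg(7)[of t] dev_nonneg(5)[of t] dev_nonneg(7)[of "Suc t"] dev_nonneg(8)[of t] zero_le_power2
      descent[OF t, folded b_def] cross z x_dev_Suc[OF t] y_dev_Suc[OF t] s_dev_Suc[OF t]]
  show "lyapunov (Suc t) \<le> (1 - \<tau>) * gap t + mean_dist t + 101 / 100 * z_dev t + 13 / 50 * y_dev t
      + 3 / 2 * s_dev t + (movement t + x_dev t) / 100000"
    unfolding lyapunov_def by (rule contr(1))
  show "lyapunov (Suc t) \<le> (1 - \<tau> / 2) * lyapunov t"
    unfolding lyapunov_def by (rule contr(2))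
qed

text \<open>
  The iterate \<open>T\<close> is reached after \<open>T - 1\<close> contractions, so one further factor \<open>r = 1 - \<tau>/2\<close> has to be
  found. Strong convexity gives \<open>|z 1 - 1 w|^2 \<le> gap 1\<close>. This settles \<open>T = 1\<close>; for \<open>T \<ge> 2\<close>
  the first step keeps only the fraction \<open>1 - \<tau>\<close> of the gap. Since the gap is at least as large as
  the distance, this and the weight \<open>1 + \<tau>\<close> of the final distance pay for the factor \<open>r^2\<close>
  that the first iterate and the missing contraction require.
\<close>

theorem linear_convergence:
  assumes "T \<ge> 1"
  shows "(norm (z T - stack w))\<^sup>2 \<le> (1 - \<tau> / 2) ^ T *
    (gap 1 + (norm (z 1 - stack w))\<^sup>2 + 15 / 7 * (\<gamma>\<^sup>2 * (norm (consensus_proj ** s 1))\<^sup>2))"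
proof -
  have \<tau>: "0 < \<tau>" "\<tau> \<le> 1 / 20"
    using step_size_pos step_size_identities by auto
  define r where "r = 1 - \<tau> / 2"
  have r: "0 \<le> r"
    using \<tau> by (simp add: r_def)
  have dist: "(norm (z t - stack w))\<^sup>2 = mean_dist t + z_dev t" for t
    by (simp add: norm_mean_deviation mean_dist_def z_dev_def)
  have init: "z_dev 1 = 0" "y_dev 1 = 0" "x_dev 1 = 0" "movement 1 = 0"
    using x_1 y_1 z_1 by (simp_all add: z_dev_def y_dev_def x_dev_def movement_def consensus_proj_stack)
  define Z0 where "Z0 = (norm (z 1 - stack w))\<^sup>2"
  have "0 \<le> Z0"
    by (simp add: Z0_def)
  with dist[of 1] init have Z0: "mean_dist 1 = Z0" "0 \<le> Z0"
    by (simp_all add: Z0_def)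
  define S0 where "S0 = s_dev 1"
  have S0: "0 \<le> S0"
    using dev_nonneg by (simp add: S0_def)
  have gap_ge: "Z0 \<le> gap 1"
  proof -
    have "Z0 = 2 / \<mu> * (real CARD('m) * \<mu> / 2 * (norm (row_mean (y 1) - w))\<^sup>2)"
      using \<mu>_pos y_1 z_1 by (simp add: Z0(1)[symmetric] mean_dist_def)
    also have "\<dots> \<le> gap 1"
      unfolding gap_def using growth[of "row_mean (y 1)"] \<mu>_pos by (intro mult_left_mono) auto
    finally show ?thesis .
  qed
  define total where "total = gap 1 + Z0 + 15 / 7 * S0"
  have "(norm (z T - stack w))\<^sup>2 \<le> r ^ T * total"
  proof (cases "T = 1")
    case True
    have "Z0 \<le> 1 / 2 * total"
      using gap_ge S0 by (simp add: total_def)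
    also have "\<dots> \<le> r * total"
      using gap_ge S0 Z0 \<tau> by (intro mult_right_mono) (auto simp: total_def r_def)
    finally show ?thesis
      using True by (simp add: Z0_def)
  next
    case False
    then obtain n where n: "T = Suc (Suc n)"
      using assms by (metis One_nat_def Suc_le_D Suc_inject not0_implies_Suc)
    have decay: "lyapunov (Suc (Suc k)) \<le> r ^ k * lyapunov 2" for k
    proof (induction k)
      case 0
      then show ?case
        by (simp add: numeral_2_eq_2)
    next
      case (Suc k)
      have "lyapunov (Suc (Suc (Suc k))) \<le> r * lyapunov (Suc (Suc k))"
        unfolding r_def by (rule lyapunov_Suc(2)) simp
      also have "\<dots> \<le> r * (r ^ k * lyapunov 2)"
        using Suc r by (rule mult_left_mono)
      finally show ?case by simp
    qed
    have "lyapunov 2 \<le> (1 - \<tau>) * gap 1 + Z0 + 3 / 2 * S0"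
      using lyapunov_Suc(1)[of 1] init Z0 by (simp add: numeral_2_eq_2 S0_def)
    also have "\<dots> \<le> (1 + \<tau>) * r\<^sup>2 * total"
    proof -
      define k where "k = (1 + \<tau>) * r\<^sup>2"
      have k: "k = 1 - 3 / 4 * (\<tau> * \<tau>) + 1 / 4 * (\<tau> * \<tau> * \<tau>)"
        by (simp add: k_def r_def power2_eq_square field_simps)
      have sq: "\<tau> * \<tau> \<le> 1 / 20 * \<tau>" "0 \<le> \<tau> * \<tau>"
        using \<tau> by (auto intro: mult_right_mono)
      have cube: "0 \<le> \<tau> * \<tau> * \<tau>"
        using \<tau> by simp
      have k1: "1 - k \<le> k - (1 - \<tau>)" "0 \<le> k - (1 - \<tau>)" "9 / 10 \<le> k"
        using sq cube \<tau> unfolding k by linarith+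
      have "(1 - k) * Z0 \<le> (k - (1 - \<tau>)) * gap 1"
        using k1 gap_ge Z0 mult_right_mono[OF k1(1) Z0(2)] mult_left_mono[OF gap_ge k1(2)] by linarith
      moreover have "3 / 2 * S0 \<le> k * (15 / 7 * S0)"
        using mult_right_mono[OF k1(3), of "15 / 7 * S0"] S0 by simp
      ultimately show ?thesis
        unfolding k_def[symmetric] total_def by (simp add: algebra_simps)
    qed
    finally have two: "lyapunov 2 \<le> (1 + \<tau>) * r\<^sup>2 * total" .
    have "(1 + \<tau>) * (norm (z T - stack w))\<^sup>2 \<le> lyapunov T"
    proof -
      have "(1 + \<tau>) * z_dev T \<le> 2 * z_dev T"
        using \<tau> dev_nonneg(3)[of T] by (intro mult_right_mono) auto
      then show ?thesis
        unfolding dist lyapunov_def distrib_left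
        using dev_nonneg[of T] by linarith
    qed
    also have "\<dots> \<le> r ^ n * lyapunov 2"
      unfolding n by (rule decay)
    also have "\<dots> \<le> r ^ n * ((1 + \<tau>) * r\<^sup>2 * total)"
      using two r by (intro mult_left_mono) auto
    also have "\<dots> = (1 + \<tau>) * (r ^ T * total)"
      by (simp add: n power2_eq_square)
    finally show ?thesis
      using \<tau> by (simp add: mult_le_cancel_left_pos)
  qed
  then show ?thesis
    by (simp add: r_def total_def Z0_def S0_def s_dev_def)
qed

end

section \<open>Convergence of the decentralised algorithm\<close>

theorem theorem5:
  fixes f :: "'m::finite \<Rightarrow> real^'d \<Rightarrow> real"
    and g :: "real^'d \<Rightarrow> real"
    and E :: "('m \<times> 'm) set"
    and W :: "real^'m^'m"
    and L \<mu> \<gamma> \<tau> c\<^sub>1 c\<^sub>2 c\<^sub>3 :: real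
    and K T :: nat
    and x1 xstar :: "real^'d"
    and x y z s :: "nat \<Rightarrow> real^'d^'m"
  assumes "connected_network E" and "weight_matrix E W"
    and "\<And>i. L_smooth L (f i)" and "\<And>i. strongly_convex \<mu> (f i)"
    and "\<mu> > 0" and "L \<ge> 2 * \<mu>"
    and "convex_on UNIV g"
    and "\<gamma> = 1 / (20 * sqrt ((L - \<mu>) * \<mu>))"
    and "\<tau> = \<mu> * \<gamma>"
    and "K = nat \<lceil>11 / sqrt (1 - second_largest_eigenval W)\<rceil>"
    and "modified_ODAPG W f g \<mu> \<gamma> \<tau> K x1 x y z s"
    and "is_arg_min (objective f g) (\<lambda>_. True) xstar"
    and "c\<^sub>1 = 64" and "c\<^sub>2 = 9 * \<tau>\<^sup>2 / 32" and "c\<^sub>3 = 5 * \<tau>\<^sup>2 / 14"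
    and "T \<ge> 1"
  shows "(norm (z T - stack xstar))\<^sup>2
    \<le> (1 - 1 / 40 * sqrt (\<mu> / (L - \<mu>))) ^ T *
      (2 * real CARD('m) / \<mu> * (objective f g (row_mean (y 1)) - objective f g xstar)
       + (norm (z 1 - stack xstar))\<^sup>2
       + 6 * 20\<^sup>2 * (L - \<mu>) / \<mu> *
         ((norm (consensus_proj ** x 1))\<^sup>2
          + c\<^sub>1 * (norm (consensus_proj ** y 1))\<^sup>2
          + c\<^sub>2 * (norm (consensus_proj ** z 1))\<^sup>2
          + c\<^sub>3 * \<gamma>\<^sup>2 * (norm (consensus_proj ** s 1))\<^sup>2))"
proof -
  define m where "m = real CARD('m)"
  have m: "m > 0"
    by (simp add: m_def)
  define l where "l = L - \<mu>"
  have l: "\<mu> \<le> l" "0 < l"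
    using \<open>\<mu> > 0\<close> \<open>L \<ge> 2 * \<mu>\<close> by (auto simp: l_def)
  define \<phi> where "\<phi> i u = f i u - \<mu> / 2 * (norm u)\<^sup>2" for i u
  define D where "D i u = gradient (f i) u - \<mu> *\<^sub>R u" for i u
  define h where "h u = g u + \<mu> / 2 * (norm u)\<^sup>2" for u
  define grads :: "real^'d^'m \<Rightarrow> real^'d^'m" where "grads = (\<lambda>X. \<chi> i. D i (X $ i))"
  define F where "F = (\<lambda>u. (\<Sum>i\<in>UNIV. \<phi> i u) + real CARD('m) * h u)"
  define p where "p t = prox_rows (\<gamma> / (1 + \<mu> * \<gamma>)) g ((1 / (1 + \<mu> * \<gamma>)) *\<^sub>R (z t - \<gamma> *\<^sub>R s (Suc t)))" for t
  note alg = \<open>modified_ODAPG W f g \<mu> \<gamma> \<tau> K x1 x y z s\<close>[unfolded modified_ODAPG_def]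
  have grads: "grad_hat \<mu> f = grads"
    by (simp add: grads_def D_def grad_hat_def fun_eq_iff)
  have W: "transpose W = W" "W *v 1 = 1"
    using \<open>weight_matrix E W\<close> by (auto simp: weight_matrix_def)
  have K: "11 / sqrt (1 - second_largest_eigenval W) \<le> real K"
    unfolding \<open>K = _\<close> by (rule real_nat_ceiling_ge)
  have smooth: "smooth_convex_grad l (\<phi> i) (D i)" for i
    using shifted_smooth_convex_grad[of L "f i" \<mu>] assms(3,4)
    by (simp add: \<phi>_def[abs_def] D_def[abs_def] l_def)
  have convex_h: "convex_on UNIV h"
    unfolding h_def[abs_def] using assms(5,7)
    by (intro convex_on_add convex_on_cmul convex_on_norm_power2) auto
  have \<gamma>: "\<gamma> > 0"
    using l \<open>\<mu> > 0\<close> \<open>\<gamma> = _\<close> by (simp add: l_def[symmetric])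
  have F_objective: "F u = m * objective f g u" for u
    by (simp add: F_def \<phi>_def h_def objective_def m_def sum_subtractf distrib_left)
  have growth: "F xstar + real CARD('m) * \<mu> / 2 * (norm (u - xstar))\<^sup>2 \<le> F u" for u
  proof -
    define \<psi> where "\<psi> v = (\<Sum>i\<in>UNIV. \<phi> i v) + m * g v" for v
    have F: "F v = \<psi> v + m * \<mu> / 2 * (norm (v - 0))\<^sup>2" for v
      by (simp add: F_def \<psi>_def h_def m_def distrib_left)
    have "convex_on UNIV \<psi>"
      unfolding \<psi>_def[abs_def] using assms(7) m smooth_convex_grad_imp_convex[OF smooth]
      by (intro convex_on_add convex_on_cmul convex_on_sum_functions) auto
    moreover have "F xstar \<le> F v" for v
      unfolding F_objective using m \<open>is_arg_min _ _ _\<close>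
      by (intro mult_left_mono) (auto simp: is_arg_min_linorder)
    ultimately have "F xstar + m * \<mu> / 2 * (norm (u - xstar))\<^sup>2 \<le> F u"
      unfolding F by (rule strongly_convex_minimizer_growth)
    then show ?thesis
      by (simp add: m_def)
  qed
  \<comment> \<open>The comparison point is the minimizer; \<open>p\<close> is the proximal output before mixing.\<close>
  interpret tracked_accelerated_run "\<lambda>X. fast_mix W X K" \<phi> D h \<mu> l \<gamma> \<tau> x1 xstar x y z s p grads F
  proof unfold_locales
    show "row_mean (fast_mix W X K) = row_mean X" for X :: "real^'d^'m"
      by (rule row_mean_fast_mix[OF W])
    show "(norm (consensus_proj ** fast_mix W X K))\<^sup>2 \<le> 1 / 8 * (norm (consensus_proj ** X))\<^sup>2" for X :: "real^'d^'m"
      by (rule fast_mix_consensus_contraction[OF \<open>weight_matrix E W\<close> K])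
    show "\<gamma> * (s (Suc t) $ i \<bullet> (p t $ i - xstar)) + \<gamma> * (h (p t $ i) - h xstar)
        + 1 / 2 * (norm (p t $ i - z t $ i))\<^sup>2 + (1 + \<tau>) / 2 * (norm (p t $ i - xstar))\<^sup>2
      \<le> 1 / 2 * (norm (z t $ i - xstar))\<^sup>2" for t i
      unfolding h_def \<open>\<tau> = _\<close>
      by (rule prox_step_inequality[OF \<open>convex_on UNIV g\<close> \<gamma> \<open>\<mu> > 0\<close>]) (simp add: p_def prox_rows_def)
  qed (use alg grads smooth convex_h l growth assms in \<open>auto simp: l_def p_def grads_def F_def\<close>)
  have "(norm (z T - stack xstar))\<^sup>2 \<le> (1 - \<tau> / 2) ^ T *
    (gap 1 + (norm (z 1 - stack xstar))\<^sup>2 + 15 / 7 * (\<gamma>\<^sup>2 * (norm (consensus_proj ** s 1))\<^sup>2))"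
    by (rule linear_convergence[OF \<open>T \<ge> 1\<close>])
  moreover have "\<tau> = 1 / 20 * sqrt (\<mu> / l)"
  proof -
    have "\<tau> = (sqrt \<mu> * sqrt \<mu>) / ((20 * sqrt l) * sqrt \<mu>)"
      using \<open>\<mu> > 0\<close> by (simp add: \<tau>_eq \<gamma>_eq real_sqrt_mult)
    also have "\<dots> = sqrt \<mu> / (20 * sqrt l)"
      using \<open>\<mu> > 0\<close> by (intro mult_divide_mult_cancel_right) simp
    finally show ?thesis
      by (simp add: real_sqrt_divide)
  qed
  moreover have "gap 1 = 2 * m / \<mu> * (objective f g (row_mean (y 1)) - objective f g xstar)"
    by (simp add: gap_def F_objective right_diff_distrib)
  \<comment> \<open>Only the tracked gradients deviate from consensus initially, and \<open>6 * 400 * l / \<mu> * c\<^sub>3 = 15/7\<close>.\<close>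
  moreover have "15 / 7 * (\<gamma>\<^sup>2 * (norm (consensus_proj ** s 1))\<^sup>2)
    = 6 * 20\<^sup>2 * l / \<mu> * ((norm (consensus_proj ** x 1))\<^sup>2 + c\<^sub>1 * (norm (consensus_proj ** y 1))\<^sup>2
        + c\<^sub>2 * (norm (consensus_proj ** z 1))\<^sup>2 + c\<^sub>3 * \<gamma>\<^sup>2 * (norm (consensus_proj ** s 1))\<^sup>2)"
  proof -
    have ratio: "l / \<mu> * \<tau>\<^sup>2 = 1 / 400"
      using step_size_identities(1) \<open>\<mu> > 0\<close> by (simp add: \<tau>_eq power2_eq_square ac_simps)
    have "6 * 20\<^sup>2 * l / \<mu> * c\<^sub>3 = 6000 / 7 * (l / \<mu> * \<tau>\<^sup>2)"
      unfolding \<open>c\<^sub>3 = _\<close> by simp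
    then have c\<^sub>3: "6 * 20\<^sup>2 * l / \<mu> * c\<^sub>3 = 15 / 7"
      unfolding ratio by linarith
    have "15 / 7 * (\<gamma>\<^sup>2 * (norm (consensus_proj ** s 1))\<^sup>2)
      = 6 * 20\<^sup>2 * l / \<mu> * (c\<^sub>3 * \<gamma>\<^sup>2 * (norm (consensus_proj ** s 1))\<^sup>2)"
      unfolding c\<^sub>3[symmetric] by simp
    moreover have "consensus_proj ** x 1 = 0" "consensus_proj ** y 1 = 0" "consensus_proj ** z 1 = 0"
      unfolding x_1 y_1 z_1 by (simp_all only: consensus_proj_stack)
    ultimately show ?thesis
      by (simp only: norm_zero power2_eq_square mult_zero_left mult_zero_right add_0)
  qed
  ultimately show ?thesis
    unfolding m_def l_def by simp
qed

end
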